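(* Suppose the assumptions on $f$ stated in the context hold. Let $\epsilon>0$ be any given target accuracy and let $\{x_t\}$ be a sequence generated by the IGRTR algorithm (see context) with $$\sigma=\frac{8\sqrt{L_2}}{9},\quad r=\frac1{3\sqrt{L_2}},\quad 0<\epsilon_1\le\min\Big\{\frac1{162},\frac{\sqrt{L_2}}{162L_1}\Big\}\epsilon^{3/2},\quad 0<\epsilon_2\le\frac{\sqrt{L_2}}{27}\epsilon^{1/2},$$ and with $\eta_y=1/\ell$, momentum parameter $\theta_y=\frac{\sqrt\kappa-1}{\sqrt\kappa+1}$, and $$N_0\ge 2\sqrt\kappa\ln\frac{\sqrt{\kappa+1}\,\|y_{-1}-y^*(x_0)\|}{A},\qquad N_t\ge 2\sqrt\kappa\ln\frac{\sqrt{\kappa+1}\,(A+\kappa\|s_{t-1}\|)}{A}\ (t\ge1),\qquad A=\min\{\epsilon_1/\ell,\ \epsilon_2/(2L_H)\}.$$ Let $\hat T(\epsilon):=\min\{t:\ \|g_t\|\le\epsilon\ \text{and}\ \lambda_{\min}(H_t)\ge-\frac49\sqrt{L_2\epsilon}\}$. Then $$\hat T(\epsilon)\le\hat C_1\epsilon^{-3/2}\ln\epsilon^{-1}+\hat C_2\epsilon^{-3/2}+1=\tilde{\mathcal O}(\ell^{1.5}\rho^{0.5}\mu^{-1.5}\epsilon^{-1.5}),$$ and $$\sum_{t=0}^{\hat T(\epsilon)}N_t\le2\sqrt\kappa\ln\frac{\sqrt{\kappa+1}\,\|y_{-1}-y^*(x_0)\|}{A}+2\sqrt\kappa\,\hat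 T(\epsilon)\ln\frac{\sqrt{\kappa+1}\,(A+\kappa r\sqrt{\hat G})}{A},$$ where $\hat C_1=486\sqrt{L_2}(P(x_0)-P^* )/\ln2$, $\hat C_2=(\ln\hat G+\ln2)\hat C_1$, $\hat G=\max\big\{2+\frac{L_1}{3\sqrt{L_2}}\hat C^{1/2}+\hat C,\ 2+\frac{L_1}{3\sqrt{L_2}}\big\}$ and $\hat C=\big(486\sqrt{L_2}(P(x_0)-P^* )\big)^{2/3}$.
   Context: Setting. $f:\mathbb{R}^n\times\mathbb{R}^m\to\mathbb{R}$ is continuously differentiable and, for every $x$, $f(x,\cdot)$ is $\mu$-strongly concave ($\mu>0$). Assumptions: (i) $\|\nabla f(x,y)-\nabla f(x',y')\|\le\ell\|(x,y)-(x',y')\|$ for all $(x,y),(x',y')$; (ii) the second-order partial derivative matrices $\nabla^2_{xx}f,\nabla^2_{xy}f,\nabla^2_{yx}f,\nabla^2_{yy}f$ are $\rho$-Lipschitz continuous; (iii) $P(x)=\max_{y\in\mathbb{R}^m}f(x,y)$ is bounded below by a constant $P^*$. $\|\cdot\|$ is the Euclidean norm of vectors and the spectral norm of matrices. Notation. $y^*(x)=\arg\max_{y}f(x,y)$; $\kappa=\ell/\mu$; $L_1=(\kappa+1)\ell$; $L_2=\rho(1+\kappa)^3$; $L_H=\rho(1+\kappa)^2$; $H(x,y)=[\nabla^2_{xx}f-\nabla^2_{xy}f(\nabla^2_{yy}f)^{-1}\nabla^2_{yx}f](x,y)$. $\tilde{\mathcal O}(\cdot)$ hides only absolute constants and logarithmic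 factors. IGRTR algorithm. Input $x_0,y_{-1}$ and parameters $\eta_y,\theta_y$ (momentum), $\sigma,r,N_t,\epsilon$. For $t=0,1,2,\dots$: (1) set $y^t_0=\tilde y^t_0=y_{t-1}$; for $k=0,\dots,N_t-1$ set $y^t_{k+1}=\tilde y^t_k+\eta_y\nabla_yf(x_t,\tilde y^t_k)$ and $\tilde y^t_{k+1}=y^t_{k+1}+\theta_y(y^t_{k+1}-y^t_k)$; set $y_t=y^t_{N_t}$. (2) Set $g_t=\nabla_xf(x_t,y_t)$, $H_t=H(x_t,y_t)$. (3) Approximately solve the trust-region subproblem $\min_{\|s\|\le r\max\{\|g_t\|^{1/2},\epsilon^{1/2}\}} g_t^\top s+\frac12s^\top(H_t+\sigma\|g_t\|^{1/2}I)s$ as follows. If $\|g_t\|>\epsilon$: by a trust-region Newton-CG method, obtain $s_t$ satisfying $g_t^\top s_t+\frac12s_t^\top H_ts_t\le-\frac18\sigma\|g_t\|^{1/2}\|s_t\|^2$ and either $\|s_t\|=r\|g_t\|^{1/2}$, or $\|s_t\|<r\|g_t\|^{1/2}$ together with $\|(H_t+\sigma\|g_t\|^{1/2}I)s_t+g_t\|\le\frac12\min\{\|g_t\|,\frac12\sigma\|g_t\|^{1/2}\|s_t\|\}$. If $\|g_t\|\le\epsilon$: by a randomized Lanczos procedure applied to $H_t$, either $\lambda_{\min}(H_t)\ge-\frac12\sigma\epsilon^{1/2}$, or else obtain $s_t$ satisfying $g_t^\top s_t+\frac12s_t^\top H_ts_t\le-\frac18\sigma\epsilon^{1/2}\|s_t\|^2$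 and $\|s_t\|=r\epsilon^{1/2}$. (4) Set $x_{t+1}=x_t+s_t$.
   Formalization: The bound on T̂ is claimed only for ε ≤ Ĉ (it can fail otherwise); in Õ the gap P(x_0)-P* is treated as bounded and the leading term as ≥ 1; the bound on ΣN_t is for the prescribed least values, plus δ(T̂+1) if each N_t exceeds them by at most δ. *)

theory Defs
  imports "HOL-Analysis.Analysis"
begin

section \<open>The objective function\<close>

text \<open>
  The objective is a function \<open>f\<close> of the pair \<open>(x, y)\<close>; the norm of the product type
  \<open>(real^'n) \<times> (real^'m)\<close> is the Euclidean one.
\<close>

definition grad :: "('a::real_inner \<Rightarrow> real) \<Rightarrow> 'a \<Rightarrow> 'a" where
  "grad g z = (THE D. GDERIV g z :> D)"

definition grad_x :: "((real^'n) \<times> (real^'m) \<Rightarrow> real) \<Rightarrow> real^'n \<Rightarrow> real^'m \<Rightarrow> real^'n" where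
  "grad_x f x y = grad (\<lambda>u. f (u, y)) x"

definition grad_y :: "((real^'n) \<times> (real^'m) \<Rightarrow> real) \<Rightarrow> real^'n \<Rightarrow> real^'m \<Rightarrow> real^'m" where
  "grad_y f x y = grad (\<lambda>v. f (x, v)) y"

definition hess_xx :: "((real^'n) \<times> (real^'m) \<Rightarrow> real) \<Rightarrow> real^'n \<Rightarrow> real^'m \<Rightarrow> real^'n^'n" where
  "hess_xx f x y = jacobian (\<lambda>u. grad_x f u y) (at x)"

definition hess_xy :: "((real^'n) \<times> (real^'m) \<Rightarrow> real) \<Rightarrow> real^'n \<Rightarrow> real^'m \<Rightarrow> real^'m^'n" where
  "hess_xy f x y = jacobian (\<lambda>v. grad_x f x v) (at y)"

definition hess_yx :: "((real^'n) \<times> (real^'m) \<Rightarrow> real) \<Rightarrow> real^'n \<Rightarrow> real^'m \<Rightarrow> real^'n^'m" where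
  "hess_yx f x y = jacobian (\<lambda>u. grad_y f u y) (at x)"

definition hess_yy :: "((real^'n) \<times> (real^'m) \<Rightarrow> real) \<Rightarrow> real^'n \<Rightarrow> real^'m \<Rightarrow> real^'m^'m" where
  "hess_yy f x y = jacobian (\<lambda>v. grad_y f x v) (at y)"

definition twice_partially_differentiable :: "((real^'n) \<times> (real^'m) \<Rightarrow> real) \<Rightarrow> bool" where
  "twice_partially_differentiable f \<longleftrightarrow>
     (\<forall>x y. (\<lambda>u. grad_x f u y) differentiable (at x) \<and>
            (\<lambda>v. grad_x f x v) differentiable (at y) \<and>
            (\<lambda>u. grad_y f u y) differentiable (at x) \<and>
            (\<lambda>v. grad_y f x v) differentiable (at y))"

text \<open>
  The type class norm on \<open>real^'n^'m\<close> is the Frobenius norm, hence this definition.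
\<close>
definition spectral_norm :: "real^'n^'m \<Rightarrow> real" where
  "spectral_norm M = onorm ((*v) M)"

definition lipschitz_matrix ::
    "real \<Rightarrow> (real^'n \<Rightarrow> real^'m \<Rightarrow> real^'k^'l) \<Rightarrow> bool" where
  "lipschitz_matrix \<rho> M \<longleftrightarrow>
     (\<forall>x y x' y'. spectral_norm (M x y - M x' y') \<le> \<rho> * norm ((x, y) - (x', y')))"

definition strongly_concave :: "real \<Rightarrow> ('a::real_inner \<Rightarrow> real) \<Rightarrow> bool" where
  "strongly_concave \<mu> g \<longleftrightarrow>
     (\<forall>y y' t. 0 \<le> t \<and> t \<le> 1 \<longrightarrow>
        g ((1 - t) *\<^sub>R y + t *\<^sub>R y')
          \<ge> (1 - t) * g y + t * g y' + \<mu> / 2 * t * (1 - t) * (norm (y - y'))\<^sup>2)"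

text \<open>The primal function \<open>P\<close> and the maximiser \<open>y\<^sup>*\<close>; under strong concavity the supremum is attained.\<close>

definition primal :: "((real^'n) \<times> (real^'m) \<Rightarrow> real) \<Rightarrow> real^'n \<Rightarrow> real" where
  "primal f x = (SUP y. f (x, y))"

definition y_star :: "((real^'n) \<times> (real^'m) \<Rightarrow> real) \<Rightarrow> real^'n \<Rightarrow> real^'m" where
  "y_star f x = arg_max (\<lambda>y. f (x, y)) (\<lambda>_. True)"

definition minimax_assumptions ::
    "((real^'n) \<times> (real^'m) \<Rightarrow> real) \<Rightarrow> real \<Rightarrow> real \<Rightarrow> real \<Rightarrow> real \<Rightarrow> bool" where
  "minimax_assumptions f l \<mu> \<rho> Pstar \<longleftrightarrow>
     (\<forall>z. f differentiable (at z)) \<and> continuous_on UNIV (grad f) \<and>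
     (\<forall>x. strongly_concave \<mu> (\<lambda>y. f (x, y))) \<and>
     (\<forall>z z'. norm (grad f z - grad f z') \<le> l * norm (z - z')) \<and>
     twice_partially_differentiable f \<and>
     lipschitz_matrix \<rho> (hess_xx f) \<and> lipschitz_matrix \<rho> (hess_xy f) \<and>
     lipschitz_matrix \<rho> (hess_yx f) \<and> lipschitz_matrix \<rho> (hess_yy f) \<and>
     (\<forall>x. Pstar \<le> primal f x)"

definition schur_hess :: "((real^'n) \<times> (real^'m) \<Rightarrow> real) \<Rightarrow> real^'n \<Rightarrow> real^'m \<Rightarrow> real^'n^'n" where
  "schur_hess f x y =
     hess_xx f x y - hess_xy f x y ** matrix_inv (hess_yy f x y) ** hess_yx f x y"

definition lambda_min :: "real^'n^'n \<Rightarrow> real" where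
  "lambda_min M = Min {c. \<exists>v. v \<noteq> 0 \<and> M *v v = c *\<^sub>R v}"


section \<open>The algorithm\<close>

text \<open>
  Accelerated gradient ascent on \<open>g\<close>: the state is the pair \<open>(y\<^sub>k, \<tilde>y\<^sub>k)\<close>.
\<close>
fun nag :: "('a::real_inner \<Rightarrow> real) \<Rightarrow> real \<Rightarrow> real \<Rightarrow> 'a \<Rightarrow> nat \<Rightarrow> 'a \<times> 'a" where
  "nag g \<eta> \<theta> y0 0 = (y0, y0)"
| "nag g \<eta> \<theta> y0 (Suc k) =
     (let (y, w) = nag g \<eta> \<theta> y0 k;
          y' = w + \<eta> *\<^sub>R grad g w
      in (y', y' + \<theta> *\<^sub>R (y' - y)))"

text \<open>Outcome of the trust-region Newton-CG method, for \<open>norm g > \<epsilon>\<close>.\<close>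
definition newton_cg_step ::
    "real \<Rightarrow> real \<Rightarrow> real^'n \<Rightarrow> real^'n^'n \<Rightarrow> real^'n \<Rightarrow> bool" where
  "newton_cg_step \<sigma> r g H s \<longleftrightarrow>
     g \<bullet> s + 1/2 * (s \<bullet> (H *v s)) \<le> - (1/8) * \<sigma> * sqrt (norm g) * (norm s)\<^sup>2 \<and>
     (norm s = r * sqrt (norm g) \<or>
      norm s < r * sqrt (norm g) \<and>
      norm ((H + (\<sigma> * sqrt (norm g)) *\<^sub>R mat 1) *v s + g)
        \<le> 1/2 * min (norm g) (1/2 * \<sigma> * sqrt (norm g) * norm s))"

text \<open>
  Outcome of the Lanczos procedure, for \<open>norm g \<le> \<epsilon>\<close>, when it does not certify
  \<open>\<lambda>\<^sub>m\<^sub>i\<^sub>n(H) \<ge> - \<sigma> \<epsilon>\<^sup>1\<^sup>/\<^sup>2 / 2\<close>.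
\<close>
definition negative_curvature_step ::
    "real \<Rightarrow> real \<Rightarrow> real \<Rightarrow> real^'n \<Rightarrow> real^'n^'n \<Rightarrow> real^'n \<Rightarrow> bool" where
  "negative_curvature_step \<sigma> r \<epsilon> g H s \<longleftrightarrow>
     g \<bullet> s + 1/2 * (s \<bullet> (H *v s)) \<le> - (1/8) * \<sigma> * sqrt \<epsilon> * (norm s)\<^sup>2 \<and>
     norm s = r * sqrt \<epsilon>"

text \<open>
  With \<open>\<sigma> = 8 sqrt L2 / 9\<close> the curvature threshold of this test is \<open>- (4/9) sqrt (L2 \<epsilon>)\<close>.
\<close>
definition igrtr_stop ::
    "real \<Rightarrow> real \<Rightarrow> real^'n \<Rightarrow> real^'n^'n \<Rightarrow> bool" where
  "igrtr_stop \<sigma> \<epsilon> g H \<longleftrightarrow> norm g \<le> \<epsilon> \<and> lambda_min H \<ge> - (1/2) * \<sigma> * sqrt \<epsilon>"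

text \<open>
  \<open>y_prev y_init y t\<close> is \<open>y\<^sub>t\<^sub>-\<^sub>1\<close>, with \<open>y_init\<close> in the role of \<open>y\<^sub>-\<^sub>1\<close>.
\<close>
definition y_prev :: "'a \<Rightarrow> (nat \<Rightarrow> 'a) \<Rightarrow> nat \<Rightarrow> 'a" where
  "y_prev y_init y t = (case t of 0 \<Rightarrow> y_init | Suc t' \<Rightarrow> y t')"

text \<open>
  Iteration \<open>t\<close> is \<^emph>\<open>reached\<close> if the stopping test failed at all earlier iterations.
  Nothing is required of the sequences once the test has succeeded: the algorithm does not
  provide a step \<open>s\<^sub>t\<close> in that case.
\<close>
definition igrtr_reached ::
    "((real^'n) \<times> (real^'m) \<Rightarrow> real) \<Rightarrow> real \<Rightarrow> real
      \<Rightarrow> (nat \<Rightarrow> real^'n) \<Rightarrow> (nat \<Rightarrow> real^'m) \<Rightarrow> nat \<Rightarrow> bool" where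
  "igrtr_reached f \<sigma> \<epsilon> x y t \<longleftrightarrow>
     (\<forall>k<t. \<not> igrtr_stop \<sigma> \<epsilon> (grad_x f (x k) (y k)) (schur_hess f (x k) (y k)))"

text \<open>
  The initial point \<open>x\<^sub>0\<close> is \<open>x 0\<close>. The two subproblem solvers enter through their outcomes,
  so that every run in which they deliver what they are specified to deliver is covered.
\<close>
definition igrtr_run ::
    "((real^'n) \<times> (real^'m) \<Rightarrow> real) \<Rightarrow> real \<Rightarrow> real \<Rightarrow> real \<Rightarrow> real \<Rightarrow> (nat \<Rightarrow> nat) \<Rightarrow> real
      \<Rightarrow> real^'m \<Rightarrow> (nat \<Rightarrow> real^'n) \<Rightarrow> (nat \<Rightarrow> real^'m) \<Rightarrow> (nat \<Rightarrow> real^'n) \<Rightarrow> bool" where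
  "igrtr_run f \<eta> \<theta> \<sigma> r N \<epsilon> y_init x y s \<longleftrightarrow>
     (\<forall>t. igrtr_reached f \<sigma> \<epsilon> x y t \<longrightarrow>
        y t = fst (nag (\<lambda>v. f (x t, v)) \<eta> \<theta> (y_prev y_init y t) (N t)) \<and>
        (let g = grad_x f (x t) (y t); H = schur_hess f (x t) (y t) in
           (norm g > \<epsilon> \<longrightarrow> newton_cg_step \<sigma> r g H (s t)) \<and>
           (norm g \<le> \<epsilon> \<and> \<not> lambda_min H \<ge> - (1/2) * \<sigma> * sqrt \<epsilon> \<longrightarrow>
              negative_curvature_step \<sigma> r \<epsilon> g H (s t)) \<and>
           (\<not> igrtr_stop \<sigma> \<epsilon> g H \<longrightarrow> x (Suc t) = x t + s t)))"


section \<open>Constants\<close>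

text \<open>
  Here \<open>l\<close> is the gradient Lipschitz constant \<open>\<ell>\<close> and \<open>\<Delta>\<close> is the initial gap \<open>P(x\<^sub>0) - P\<^sup>*\<close>.
\<close>

definition kappa :: "real \<Rightarrow> real \<Rightarrow> real" where
  "kappa l \<mu> = l / \<mu>"

definition L1 :: "real \<Rightarrow> real \<Rightarrow> real" where
  "L1 l \<mu> = (kappa l \<mu> + 1) * l"

definition L2 :: "real \<Rightarrow> real \<Rightarrow> real \<Rightarrow> real" where
  "L2 l \<mu> \<rho> = \<rho> * (1 + kappa l \<mu>) ^ 3"

definition LH :: "real \<Rightarrow> real \<Rightarrow> real \<Rightarrow> real" where
  "LH l \<mu> \<rho> = \<rho> * (1 + kappa l \<mu>)\<^sup>2"

definition C_hat :: "real \<Rightarrow> real \<Rightarrow> real \<Rightarrow> real \<Rightarrow> real" where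
  "C_hat l \<mu> \<rho> \<Delta> = (486 * sqrt (L2 l \<mu> \<rho>) * \<Delta>) powr (2/3)"

definition G_hat :: "real \<Rightarrow> real \<Rightarrow> real \<Rightarrow> real \<Rightarrow> real" where
  "G_hat l \<mu> \<rho> \<Delta> =
     max (2 + L1 l \<mu> / (3 * sqrt (L2 l \<mu> \<rho>)) * sqrt (C_hat l \<mu> \<rho> \<Delta>) + C_hat l \<mu> \<rho> \<Delta>)
         (2 + L1 l \<mu> / (3 * sqrt (L2 l \<mu> \<rho>)))"

definition C1_hat :: "real \<Rightarrow> real \<Rightarrow> real \<Rightarrow> real \<Rightarrow> real" where
  "C1_hat l \<mu> \<rho> \<Delta> = 486 * sqrt (L2 l \<mu> \<rho>) * \<Delta> / ln 2"

definition C2_hat :: "real \<Rightarrow> real \<Rightarrow> real \<Rightarrow> real \<Rightarrow> real" where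
  "C2_hat l \<mu> \<rho> \<Delta> = (ln (G_hat l \<mu> \<rho> \<Delta>) + ln 2) * C1_hat l \<mu> \<rho> \<Delta>"

definition T_bound :: "real \<Rightarrow> real \<Rightarrow> real \<Rightarrow> real \<Rightarrow> real \<Rightarrow> real" where
  "T_bound l \<mu> \<rho> \<Delta> \<epsilon> =
     C1_hat l \<mu> \<rho> \<Delta> * \<epsilon> powr (-3/2) * ln (inverse \<epsilon>) + C2_hat l \<mu> \<rho> \<Delta> * \<epsilon> powr (-3/2) + 1"

text \<open>
  The least number of inner iterations prescribed at step \<open>t\<close>, as a real number; \<open>d0\<close> is
  \<open>norm (y\<^sub>-\<^sub>1 - y\<^sup>*(x\<^sub>0))\<close>. For \<open>d0 = 0\<close> the paper's bound is \<open>- \<infinity>\<close> and here \<open>ln 0 = 0\<close>; both leave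
  the natural number \<open>N 0\<close> unrestricted.
\<close>
definition N_required ::
    "real \<Rightarrow> real \<Rightarrow> real \<Rightarrow> (nat \<Rightarrow> 'a::real_normed_vector) \<Rightarrow> nat \<Rightarrow> real" where
  "N_required \<kappa> A d0 s t =
     (case t of
        0 \<Rightarrow> 2 * sqrt \<kappa> * ln (sqrt (\<kappa> + 1) * d0 / A)
      | Suc t' \<Rightarrow> 2 * sqrt \<kappa> * ln (sqrt (\<kappa> + 1) * (A + \<kappa> * norm (s t')) / A))"

text \<open>
  \<open>F\<close> is \<open>\<tilde>O(G)\<close> uniformly over the parameter set \<open>S\<close>, with logarithmic factors
  measured by \<open>L\<close>. Only parameters with \<open>G p \<ge> 1\<close> are considered, as a nonasymptotic form of
  "\<open>G\<close> large": an additive constant in \<open>F\<close> cannot be absorbed by a small \<open>G\<close>.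
\<close>
definition soft_O ::
    "'p set \<Rightarrow> ('p \<Rightarrow> real) \<Rightarrow> ('p \<Rightarrow> real) \<Rightarrow> ('p \<Rightarrow> real) \<Rightarrow> bool" where
  "soft_O S L F G \<longleftrightarrow>
     (\<exists>C>0. \<exists>k::nat. \<forall>p\<in>S. 1 \<le> G p \<longrightarrow> \<bar>F p\<bar> \<le> C * L p ^ k * G p)"

text \<open>
  \<open>T_bound = \<tilde>O(\<ell>\<^sup>1\<^sup>.\<^sup>5 \<rho>\<^sup>0\<^sup>.\<^sup>5 \<mu>\<^sup>-\<^sup>1\<^sup>.\<^sup>5 \<epsilon>\<^sup>-\<^sup>1\<^sup>.\<^sup>5)\<close>. The initial gap \<open>\<Delta>\<close> is absent from the
  right-hand side although \<open>T_bound\<close> grows like \<open>\<Delta>\<close>, so it counts as a bounded quantity: for every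
  bound \<open>D\<close> on it the hidden constants are independent of \<open>\<ell>\<close>, \<open>\<mu>\<close>, \<open>\<rho>\<close>, \<open>\<epsilon>\<close>, and of
  the function and its dimensions.
\<close>
definition T_bound_soft_O :: bool where
  "T_bound_soft_O \<longleftrightarrow>
     (\<forall>D\<ge>0. soft_O
        {(l, \<mu>, \<rho>, \<Delta>, \<epsilon>). 0 < \<mu> \<and> \<mu> \<le> l \<and> 0 < \<rho> \<and> 0 \<le> \<Delta> \<and> \<Delta> \<le> D \<and> 0 < \<epsilon>}
        (\<lambda>(l, \<mu>, \<rho>, \<Delta>, \<epsilon>). 1 + \<bar>ln l\<bar> + \<bar>ln \<mu>\<bar> + \<bar>ln \<rho>\<bar> + \<bar>ln \<epsilon>\<bar>)
        (\<lambda>(l, \<mu>, \<rho>, \<Delta>, \<epsilon>). T_bound l \<mu> \<rho> \<Delta> \<epsilon>)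
        (\<lambda>(l, \<mu>, \<rho>, \<Delta>, \<epsilon>).
            l powr (3/2) * \<rho> powr (1/2) * \<mu> powr (-3/2) * \<epsilon> powr (-3/2)))"

end

theory Submission
  imports Defs
begin

text \<open>
  Since \<open>y\<^sup>*\<close> is \<open>\<kappa>\<close>-Lipschitz, \<open>P\<close> has gradient \<open>\<nabla>\<^sub>x f(x, y\<^sup>*(x))\<close>, and substituting the linearised
  optimality condition of \<open>y\<^sup>*\<close> into the expansion of \<open>\<nabla>\<^sub>x f\<close> yields \<open>\<nabla>P(x + s) = \<nabla>P(x) + H s + O(|s|\<^sup>2)\<close>
  with \<open>H\<close> the Schur complement and constant \<open>L2 / 2\<close>; differentiability of \<open>y\<^sup>*\<close> is not needed.
  Accelerated ascent keeps \<open>|y\<^sub>t - y\<^sup>*(x\<^sub>t)| \<le> A\<close>, so \<open>g\<^sub>t\<close> and \<open>H\<^sub>t\<close> are accurate enough for two facts: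
  a step on the boundary of the trust region decreases \<open>P\<close> by a multiple of \<open>\<epsilon>\<^sup>3\<^sup>/\<^sup>2 / sqrt L2\<close>, and an interior
  step does not increase \<open>P\<close> and halves the gradient. As \<open>P\<close> is bounded below there are few boundary
  steps, and between two of them only logarithmically many interior ones, because
  \<open>|\<nabla>P|\<^sup>2 \<le> 2 L1 (P(x\<^sub>0) - P\<^sup>*)\<close> along the whole run.

  The accuracy requirements are used only through \<open>\<ell> A \<le> sqrt L2 \<epsilon>\<^sup>3\<^sup>/\<^sup>2 / (162 L1)\<close> and
  \<open>LH A \<le> sqrt (L2 \<epsilon>) / 54\<close>, which suffice for every \<open>\<epsilon>\<close>, including \<open>\<epsilon> > 1\<close>.
\<close>

section \<open>Taylor bounds and gradients\<close>

text \<open>Mean value inequality against \<open>c * t ^ Suc k / (k + 1)\<close>. The exponent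
  \<open>k = 1\<close> serves first-order remainders, \<open>k = 2\<close> the second-order
  one.\<close>

lemma norm_Taylor_bound:
  fixes g :: "real \<Rightarrow> 'b::real_normed_vector"
  assumes deriv: "\<And>t. (g has_vector_derivative g' t) (at t)"
    and bound: "\<And>t. 0 < t \<Longrightarrow> t < 1 \<Longrightarrow> norm (g' t) \<le> c * t ^ k"
  shows "norm (g 1 - g 0) \<le> c / (real k + 1)"
proof -
  let ?\<phi> = "\<lambda>t. c / (real k + 1) * t ^ Suc k"
  have "norm (g 1 - g 0) \<le> ?\<phi> 1 - ?\<phi> 0"
  proof (rule differentiable_bound_general)
    show "continuous_on {0..1} g"
      by (meson deriv continuous_at_imp_continuous_on has_vector_derivative_continuous)
    have "c / (real k + 1) * ((real k + 1) * t ^ k) = c * t ^ k" for t :: real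
      by (simp add: field_simps)
    then show "(?\<phi> has_vector_derivative c * t ^ k) (at t)" for t :: real
      using DERIV_cmult[OF DERIV_pow[of "Suc k" t], of "c / (real k + 1)"]
      unfolding has_real_derivative_iff_has_vector_derivative[symmetric] by (simp add: add.commute)
  qed (use assms in \<open>auto intro!: continuous_intros\<close>)
  then show ?thesis by simp
qed

lemma has_derivative_line:
  assumes "(F has_derivative F') (at (x + t *\<^sub>R s))"
  shows "((\<lambda>t. F (x + t *\<^sub>R s)) has_vector_derivative F' s) (at t)"
proof -
  interpret F': bounded_linear F' using assms by (rule has_derivative_bounded_linear)
  have "((\<lambda>t. x + t *\<^sub>R s) has_derivative (\<lambda>h. h *\<^sub>R s)) (at t)"
    by (auto intro!: derivative_eq_intros)
  from diff_chain_at[OF this, of F F'] assms show ?thesis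
    by (simp add: has_vector_derivative_def o_def F'.scaleR)
qed

text \<open>Along the segment, subtracting the linear part leaves a derivative of size
  \<open>L * t * norm s ^ 2\<close>; its integral brings the factor 1/2.\<close>

lemma Taylor_lipschitz:
  fixes F :: "'a::real_normed_vector \<Rightarrow> 'b::real_normed_vector"
  assumes deriv: "\<And>z. (F has_derivative F' z) (at z)"
    and lip: "\<And>z s. norm (F' z s - F' x s) \<le> L * norm (z - x) * norm s"
  shows "norm (F (x + s) - F x - F' x s) \<le> L / 2 * (norm s)\<^sup>2"
proof -
  have "norm ((F (x + 1 *\<^sub>R s) - 1 *\<^sub>R F' x s) - (F (x + 0 *\<^sub>R s) - 0 *\<^sub>R F' x s)) \<le> L * (norm s)\<^sup>2 / (real 1 + 1)"
  proof (rule norm_Taylor_bound[where g = "\<lambda>t. F (x + t *\<^sub>R s) - t *\<^sub>R F' x s" and c = "L * (norm s)\<^sup>2" and k = 1])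
    show "((\<lambda>t. F (x + t *\<^sub>R s) - t *\<^sub>R F' x s) has_vector_derivative F' (x + t *\<^sub>R s) s - F' x s) (at t)" for t
      using has_derivative_line[OF deriv]
      by (auto intro!: derivative_eq_intros)
    show "norm (F' (x + t *\<^sub>R s) s - F' x s) \<le> L * (norm s)\<^sup>2 * t ^ 1" if "0 < t" "t < 1" for t
      using lip[of "x + t *\<^sub>R s" s] that by (simp add: power2_eq_square mult_ac)
  qed
  then show ?thesis by (simp add: algebra_simps)
qed

text \<open>\<open>H\<close> is tied to \<open>g\<close> by a remainder bound, so it can be the
  Schur complement without \<open>y_star\<close> ever being differentiated. Homogeneity moves
  \<open>t\<close> inside \<open>H\<close>, where that bound applies.\<close>

lemma Taylor_second_order:
  fixes P :: "'a::real_inner \<Rightarrow> real"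
  assumes deriv: "\<And>z. GDERIV P z :> g z"
    and bound: "\<And>s. norm (g (x + s) - g x - H s) \<le> L / 2 * (norm s)\<^sup>2"
    and lin: "\<And>t s. H (t *\<^sub>R s) = t *\<^sub>R H s"
  shows "\<bar>P (x + s) - P x - g x \<bullet> s - 1/2 * (s \<bullet> H s)\<bar> \<le> L / 6 * norm s ^ 3"
proof -
  let ?G = "\<lambda>t. P (x + t *\<^sub>R s) - t * (g x \<bullet> s) - t\<^sup>2 / 2 * (s \<bullet> H s)"
  have "norm (?G 1 - ?G 0) \<le> L / 2 * norm s ^ 3 / (real 2 + 1)"
  proof (rule norm_Taylor_bound)
    have "((\<lambda>t. P (x + t *\<^sub>R s)) has_real_derivative s \<bullet> g (x + t *\<^sub>R s)) (at t)" for t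
      using has_derivative_line[OF deriv[unfolded gderiv_def]]
      by (simp add: has_real_derivative_iff_has_vector_derivative)
    then show "(?G has_vector_derivative s \<bullet> g (x + t *\<^sub>R s) - g x \<bullet> s - t * (s \<bullet> H s)) (at t)" for t
      unfolding has_real_derivative_iff_has_vector_derivative[symmetric]
      by (auto intro!: derivative_eq_intros)
    show "norm (s \<bullet> g (x + t *\<^sub>R s) - g x \<bullet> s - t * (s \<bullet> H s)) \<le> L / 2 * norm s ^ 3 * t\<^sup>2"
      if "0 < t" "t < 1" for t
    proof -
      have "s \<bullet> g (x + t *\<^sub>R s) - g x \<bullet> s - t * (s \<bullet> H s) = s \<bullet> (g (x + t *\<^sub>R s) - g x - H (t *\<^sub>R s))"
        by (simp add: inner_diff_right lin inner_commute)
      also have "\<bar>\<dots>\<bar> \<le> norm s * norm (g (x + t *\<^sub>R s) - g x - H (t *\<^sub>R s))"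
        by (rule Cauchy_Schwarz_ineq2)
      also have "\<dots> \<le> norm s * (L / 2 * (norm (t *\<^sub>R s))\<^sup>2)"
        by (intro mult_left_mono bound) auto
      finally show ?thesis by (simp add: power_mult_distrib mult_ac eval_nat_numeral)
    qed
  qed
  then have "\<bar>P (x + s) - P x - g x \<bullet> s - 1/2 * (s \<bullet> H s)\<bar> \<le> L / 2 * norm s ^ 3 / (real 2 + 1)"
    by (simp add: algebra_simps)
  then show ?thesis by simp
qed

text \<open>Serves \<open>primal f\<close>, whose derivative comes from an explicit expansion
  instead of a chain rule through \<open>y_star\<close>.\<close>

lemma has_derivative_quadratic_remainder:
  assumes bl: "bounded_linear F'"
    and bound: "\<And>h. norm (F (x + h) - F x - F' h) \<le> c * (norm h)\<^sup>2"
  shows "(F has_derivative F') (at x)"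
  unfolding has_derivative_at_alt
proof (intro conjI allI impI bl)
  fix e :: real assume "0 < e"
  show "\<exists>d>0. \<forall>y. norm (y - x) < d \<longrightarrow> norm (F y - F x - F' (y - x)) \<le> e * norm (y - x)"
  proof (intro exI conjI allI impI)
    \<comment> \<open>The sign of \<open>c\<close> is unknown; \<open>\<bar>c\<bar> + 1\<close> is a
      positive majorant.\<close>
    show "0 < e / (\<bar>c\<bar> + 1)" using \<open>0 < e\<close> by simp
    fix y assume less: "norm (y - x) < e / (\<bar>c\<bar> + 1)"
    have "norm (F y - F x - F' (y - x)) \<le> c * (norm (y - x))\<^sup>2"
      using bound[of "y - x"] by simp
    also have "\<dots> \<le> ((\<bar>c\<bar> + 1) * norm (y - x)) * norm (y - x)"
      by (simp add: power2_eq_square mult.assoc mult_right_mono)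
    also have "\<dots> \<le> e * norm (y - x)"
      using less by (intro mult_right_mono) (auto simp: field_simps)
    finally show "norm (F y - F x - F' (y - x)) \<le> e * norm (y - x)" .
  qed
qed

text \<open>One suitable \<open>t\<close> per tolerance is enough below: dividing by
  \<open>t\<close> carries a bound on difference quotients over to \<open>F' v\<close> up to
  \<open>e\<close>, and \<open>e\<close> is arbitrary.\<close>

lemma small_difference_quotient:
  assumes deriv: "(F has_derivative F') (at x)" and "0 < e"
  obtains t :: real where "0 < t" and "norm (F (x + t *\<^sub>R v) - F x - t *\<^sub>R F' v) \<le> e * t"
proof (cases "v = 0")
  case False
  interpret F': bounded_linear F' using deriv by (rule has_derivative_bounded_linear)
  have "0 < e / norm v" using \<open>0 < e\<close> False by simp
  then obtain d where d: "0 < d"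
    "\<And>y. norm (y - x) < d \<Longrightarrow> norm (F y - F x - F' (y - x)) \<le> e / norm v * norm (y - x)"
    using deriv unfolding has_derivative_at_alt by meson
  define t where "t = d / (2 * norm v)"
  have t: "0 < t" "norm (t *\<^sub>R v) < d" using d(1) False by (auto simp: t_def field_simps)
  show thesis
    using d(2)[of "x + t *\<^sub>R v"] t False by (intro that[OF t(1)]) (simp add: F'.scaleR)
next
  case True
  interpret F': bounded_linear F' using deriv by (rule has_derivative_bounded_linear)
  show thesis using that[of 1] True \<open>0 < e\<close> by (simp add: F'.zero)
qed

lemma norm_derivative_le_lipschitz:
  assumes deriv: "(F has_derivative F') (at x)"
    and lip: "\<And>z. norm (F z - F x) \<le> L * norm (z - x)"
  shows "norm (F' v) \<le> L * norm v"
proof (rule field_le_epsilon)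
  fix e :: real assume "0 < e"
  with deriv obtain t where t: "0 < t" "norm (F (x + t *\<^sub>R v) - F x - t *\<^sub>R F' v) \<le> e * t"
    by (rule small_difference_quotient)
  have "norm (t *\<^sub>R F' v) \<le> L * (t * norm v) + e * t"
    using lip[of "x + t *\<^sub>R v"] t
      norm_triangle_ineq4[of "F (x + t *\<^sub>R v) - F x" "F (x + t *\<^sub>R v) - F x - t *\<^sub>R F' v"]
    by simp
  then have "t * norm (F' v) \<le> t * (L * norm v + e)"
    using t by (simp add: algebra_simps)
  then show "norm (F' v) \<le> L * norm v + e" using t by simp
qed

text \<open>The source of the invertibility of \<open>hess_yy\<close>: strong monotonicity makes
  \<open>grad_y\<close> expansive, and the derivative inherits this. Symmetry and eigenvalues do not
  enter.\<close>

lemma norm_derivative_ge_expansive: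
  assumes deriv: "(F has_derivative F') (at x)"
    and expansive: "\<And>z. m * norm (z - x) \<le> norm (F z - F x)"
  shows "m * norm v \<le> norm (F' v)"
proof (rule field_le_epsilon)
  fix e :: real assume "0 < e"
  with deriv obtain t where t: "0 < t" "norm (F (x + t *\<^sub>R v) - F x - t *\<^sub>R F' v) \<le> e * t"
    by (rule small_difference_quotient)
  have "m * (t * norm v) \<le> norm (t *\<^sub>R F' v) + e * t"
    using expansive[of "x + t *\<^sub>R v"] t
      norm_triangle_ineq[of "t *\<^sub>R F' v" "F (x + t *\<^sub>R v) - F x - t *\<^sub>R F' v"]
    by simp
  then have "t * (m * norm v) \<le> t * (norm (F' v) + e)"
    using t by (simp add: algebra_simps)
  then show "m * norm v \<le> norm (F' v) + e" using t by simp
qed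

section \<open>Gradients as representing vectors of derivatives\<close>

lemma GDERIV_unique:
  assumes "GDERIV f z :> D" and "GDERIV f z :> E"
  shows "D = E"
proof -
  have "(\<lambda>h. h \<bullet> D) = (\<lambda>h. h \<bullet> E)"
    using assms unfolding gderiv_def by (rule has_derivative_unique)
  then have "(D - E) \<bullet> D = (D - E) \<bullet> E" by (rule fun_cong)
  then have "(D - E) \<bullet> (D - E) = 0" by (simp add: inner_diff_right)
  then show ?thesis by simp
qed

lemma GDERIV_imp_grad: "GDERIV f z :> D \<Longrightarrow> grad f z = D"
  unfolding grad_def by (rule the_equality) (auto intro: GDERIV_unique)

text \<open>\<open>grad\<close> is a definite description, so a vector has to be exhibited: the
  Riesz representative with coordinates \<open>f' b\<close>.\<close>

lemma GDERIV_grad: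
  fixes f :: "'a::euclidean_space \<Rightarrow> real"
  assumes "f differentiable (at z)"
  shows "GDERIV f z :> grad f z"
proof -
  from assms obtain f' where f': "(f has_derivative f') (at z)"
    by (auto simp: differentiable_def)
  interpret f': bounded_linear f' using f' by (rule has_derivative_bounded_linear)
  have "f' h = h \<bullet> (\<Sum>b\<in>Basis. f' b *\<^sub>R b)" for h
  proof -
    have "f' h = f' (\<Sum>b\<in>Basis. (h \<bullet> b) *\<^sub>R b)" by (simp add: euclidean_representation)
    also have "\<dots> = h \<bullet> (\<Sum>b\<in>Basis. f' b *\<^sub>R b)"
      by (simp add: f'.sum f'.scaleR inner_sum_right mult.commute)
    finally show ?thesis .
  qed
  then have "f' = (\<lambda>h. h \<bullet> (\<Sum>b\<in>Basis. f' b *\<^sub>R b))" by (rule ext)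
  then have *: "GDERIV f z :> (\<Sum>b\<in>Basis. f' b *\<^sub>R b)"
    using f' by (simp add: gderiv_def)
  then show ?thesis by (simp add: GDERIV_imp_grad)
qed

section \<open>Accelerated gradient ascent\<close>

text \<open>Strong concavity on the segment, divided by \<open>t\<close>, bounds a difference
  quotient from below; letting \<open>t\<close> tend to 0 from the right turns the quotient into the
  directional derivative.\<close>

lemma strongly_concave_gradient:
  assumes conc: "strongly_concave \<mu> g" and deriv: "GDERIV g y :> D"
  shows "g y' \<le> g y + D \<bullet> (y' - y) - \<mu> / 2 * (norm (y' - y))\<^sup>2"
proof -
  let ?h = "\<lambda>t. g (y + t *\<^sub>R (y' - y))"
  have "(?h has_vector_derivative (y' - y) \<bullet> D) (at 0)"
    by (rule has_derivative_line) (use deriv in \<open>simp add: gderiv_def\<close>)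
  then have "(?h has_real_derivative (y' - y) \<bullet> D) (at 0 within {0<..})"
    by (simp add: has_real_derivative_iff_has_vector_derivative has_vector_derivative_at_within)
  then have lim: "((\<lambda>t. (?h t - g y) / t) \<longlongrightarrow> (y' - y) \<bullet> D) (at_right 0)"
    by (simp add: has_field_derivative_iff)
  have "((\<lambda>t. g y' - g y + \<mu> / 2 * (1 - t) * (norm (y' - y))\<^sup>2)
      \<longlongrightarrow> g y' - g y + \<mu> / 2 * (1 - 0) * (norm (y' - y))\<^sup>2) (at_right 0)"
    by (intro tendsto_intros)
  moreover have "\<forall>\<^sub>F t in at_right 0. g y' - g y + \<mu> / 2 * (1 - t) * (norm (y' - y))\<^sup>2 \<le> (?h t - g y) / t"
    unfolding eventually_at_right_field
  proof (intro exI[of _ 1] conjI allI impI)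
    fix t :: real assume t: "0 < t" "t < 1"
    have "(1 - t) * g y + t * g y' + \<mu> / 2 * t * (1 - t) * (norm (y - y'))\<^sup>2 \<le> g ((1 - t) *\<^sub>R y + t *\<^sub>R y')"
      using conc t by (auto simp: strongly_concave_def)
    also have "(1 - t) *\<^sub>R y + t *\<^sub>R y' = y + t *\<^sub>R (y' - y)"
      by (simp add: algebra_simps)
    finally have "t * (g y' - g y + \<mu> / 2 * (1 - t) * (norm (y' - y))\<^sup>2) \<le> ?h t - g y"
      by (simp add: algebra_simps norm_minus_commute)
    then show "g y' - g y + \<mu> / 2 * (1 - t) * (norm (y' - y))\<^sup>2 \<le> (?h t - g y) / t"
      using t by (simp add: field_simps)
  qed simp
  ultimately have "g y' - g y + \<mu> / 2 * (1 - 0) * (norm (y' - y))\<^sup>2 \<le> (y' - y) \<bullet> D"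
    by (intro tendsto_le[OF _ lim]) auto
  then show ?thesis by (simp add: inner_commute)
qed

text \<open>Coercivity: outside the ball of radius \<open>2 * norm D / \<mu>\<close> the quadratic
  term outweighs the linear one and \<open>g y \<le> g 0\<close>, so the maximum over the compact
  ball is global.\<close>

lemma strongly_concave_attains_max:
  fixes g :: "'a::euclidean_space \<Rightarrow> real"
  assumes mu: "0 < \<mu>"
    and upper: "\<And>y. g y \<le> g 0 + D \<bullet> y - \<mu> / 2 * (norm y)\<^sup>2"
    and cont: "continuous_on UNIV g"
  shows "\<exists>m. \<forall>y. g y \<le> g m"
proof -
  define R where "R = 2 * norm D / \<mu>"
  have "compact (cball (0::'a) R)" "cball (0::'a) R \<noteq> {}" "continuous_on (cball 0 R) g"
    using mu cont by (auto simp: R_def divide_less_0_iff intro: continuous_on_subset)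
  then obtain m where m: "\<And>y. y \<in> cball 0 R \<Longrightarrow> g y \<le> g m"
    using continuous_attains_sup by metis
  have "g y \<le> g m" for y
  proof (cases "norm y \<le> R")
    case False
    have "D \<bullet> y - \<mu> / 2 * (norm y)\<^sup>2 \<le> norm D * norm y - \<mu> / 2 * (norm y)\<^sup>2"
      using norm_cauchy_schwarz[of D y] by simp
    also have "\<dots> = \<mu> / 2 * norm y * (R - norm y)"
      using mu by (simp add: R_def field_simps power2_eq_square)
    also have "\<dots> \<le> 0"
      using mu False by (simp add: mult_nonneg_nonpos)
    finally have "g y \<le> g 0" using upper[of y] by simp
    also have "\<dots> \<le> g m" using mu by (intro m) (simp add: R_def)
    finally show ?thesis .
  qed (use m in simp)
  then show ?thesis by blast
qed

text \<open>The inner problem at a frozen \<open>x\<close>: \<open>upper\<close> expresses strong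
  concavity, \<open>lower\<close> smoothness with constant \<open>l\<close>.\<close>

locale strongly_concave_smooth =
  fixes g :: "'a::real_inner \<Rightarrow> real" and l \<mu> :: real and ys :: 'a
  assumes mu: "0 < \<mu>" and mu_le: "\<mu> \<le> l"
    and upper: "\<And>y y'. g y' \<le> g y + grad g y \<bullet> (y' - y) - \<mu> / 2 * (norm (y' - y))\<^sup>2"
    and lower: "\<And>y y'. g y' \<ge> g y + grad g y \<bullet> (y' - y) - l / 2 * (norm (y' - y))\<^sup>2"
    and maximum: "\<And>y. g y \<le> g ys"
begin

text \<open>An ascent step of length \<open>1 / l\<close> from \<open>ys\<close> would gain
  \<open>norm (grad g ys) ^ 2 / (2 * l)\<close>, which maximality forbids unless the gradient
  vanishes.\<close>

lemma grad_max: "grad g ys = 0"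
proof -
  have l: "0 < l" using mu mu_le by simp
  have "g ys + grad g ys \<bullet> ((1 / l) *\<^sub>R grad g ys) - l / 2 * (norm ((1 / l) *\<^sub>R grad g ys))\<^sup>2 \<le> g ys"
    using order_trans[OF lower[of ys "ys + (1 / l) *\<^sub>R grad g ys"] maximum] by simp
  then have "(norm (grad g ys))\<^sup>2 / (2 * l) \<le> 0"
    using l by (simp add: power_divide dot_square_norm power2_eq_square add_divide_distrib[symmetric] diff_divide_distrib[symmetric])
  then show ?thesis using l by (simp add: divide_le_0_iff)
qed

text \<open>
  The Lyapunov function is \<open>g y\<^sup>* - g y\<^sub>k + \<mu>/2 |z\<^sub>k - y\<^sup>*|\<^sup>2\<close> with \<open>z\<^sub>k = w\<^sub>k + sqrt \<kappa> (w\<^sub>k - y\<^sub>k)\<close>.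
\<close>

lemma nag_lyapunov_step:
  fixes y w :: 'a
  assumes p: "p = sqrt (l / \<mu>)"
    and y': "y' = w + (1 / l) *\<^sub>R grad g w"
    and w': "w' = y' + ((p - 1) / (p + 1)) *\<^sub>R (y' - y)"
  shows "g ys - g y' + \<mu> / 2 * (norm (w' + p *\<^sub>R (w' - y') - ys))\<^sup>2
    \<le> (1 - 1 / p) * (g ys - g y + \<mu> / 2 * (norm (w + p *\<^sub>R (w - y) - ys))\<^sup>2)"
proof -
  define D u v where "D = grad g w" and "u = w - ys" and "v = w - y"
  have p1: "1 \<le> p" using mu mu_le by (simp add: p)
  have l: "l = \<mu> * p\<^sup>2" "0 < l" using mu mu_le by (simp_all add: p)
  \<comment> \<open>The momentum coefficient is chosen so that \<open>1 + p\<close> cancels its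
    denominator, leaving the multiple \<open>p - 1\<close> of \<open>y' - y\<close>.\<close>
  have "w' + p *\<^sub>R (w' - y') = y' + ((1 + p) * ((p - 1) / (p + 1))) *\<^sub>R (y' - y)"
    unfolding w' by (simp add: distrib_right scaleR_add_left add_divide_distrib)
  also have "(1 + p) * ((p - 1) / (p + 1)) = p - 1" using p1 by (simp add: add.commute)
  also have "y' + (p - 1) *\<^sub>R (y' - y) - ys = u + (p - 1) *\<^sub>R v + (p / l) *\<^sub>R D"
    unfolding y' u_def v_def D_def
    by (simp add: algebra_simps flip: scaleR_add_left add_divide_distrib)
  finally have z': "w' + p *\<^sub>R (w' - y') - ys = u + (p - 1) *\<^sub>R v + (p / l) *\<^sub>R D" .
  have z: "w + p *\<^sub>R (w - y) - ys = u + p *\<^sub>R v"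
    by (simp add: u_def v_def)
  \<comment> \<open>Three comparisons at \<open>w\<close>: with the ascent step, with
    \<open>y\<close> by plain concavity, and with \<open>ys\<close>, where alone the strong
    concavity term is kept.\<close>
  have 1: "g w + D \<bullet> D / (2 * l) \<le> g y'"
  proof -
    have "D \<bullet> ((1 / l) *\<^sub>R D) - l / 2 * (norm ((1 / l) *\<^sub>R D))\<^sup>2 = D \<bullet> D / (2 * l)"
      using l(2) by (simp add: dot_square_norm power_divide power2_eq_square field_simps)
    then show ?thesis using lower[of w y'] by (simp add: y' D_def)
  qed
  have 2: "v \<bullet> D \<le> g w - g y"
  proof -
    have "grad g w \<bullet> (y - w) = - (v \<bullet> D)"
      by (simp add: v_def D_def inner_diff_left inner_diff_right inner_commute)
    moreover have "0 \<le> \<mu> / 2 * (norm (y - w))\<^sup>2" using mu by simp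
    ultimately show ?thesis using upper[of y w] by simp
  qed
  have 3: "u \<bullet> D \<le> g w - g ys - \<mu> / 2 * (u \<bullet> u)"
    using upper[of ys w]
    by (simp add: u_def D_def inner_diff_right inner_diff_left inner_commute power2_norm_eq_inner add.commute)
  \<comment> \<open>With this \<open>c\<close> the squared gradient in the expansion equals the gain
    in inequality 1, and inequality 3 receives the weight \<open>1 / p\<close>.\<close>
  define c where "c = p / l"
  have c: "\<mu> * c = 1 / p" "\<mu> / 2 * c\<^sup>2 = 1 / (2 * l)"
    using p1 mu by (simp_all add: c_def l(1) power2_eq_square)
  have vD: "1 / p * ((p - 1) * (v \<bullet> D)) = (1 - 1 / p) * (v \<bullet> D)"
    using p1 by (simp add: field_simps)
  have expand: "(norm (u + (p - 1) *\<^sub>R v + c *\<^sub>R D))\<^sup>2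
      = u \<bullet> u + 2 * (p - 1) * (u \<bullet> v) + (p - 1)\<^sup>2 * (v \<bullet> v)
        + 2 * c * (u \<bullet> D + (p - 1) * (v \<bullet> D)) + c\<^sup>2 * (D \<bullet> D)"
    unfolding power2_norm_eq_inner
    by (simp add: inner_add_left inner_add_right inner_commute power2_eq_square algebra_simps)
  have "\<mu> / 2 * (norm (u + (p - 1) *\<^sub>R v + c *\<^sub>R D))\<^sup>2
      = \<mu> / 2 * (u \<bullet> u + 2 * (p - 1) * (u \<bullet> v) + (p - 1)\<^sup>2 * (v \<bullet> v))
        + (\<mu> * c) * (u \<bullet> D + (p - 1) * (v \<bullet> D)) + (\<mu> / 2 * c\<^sup>2) * (D \<bullet> D)"
    unfolding expand by (simp add: algebra_simps)
  then have "g ys - g y' + \<mu> / 2 * (norm (u + (p - 1) *\<^sub>R v + (p / l) *\<^sub>R D))\<^sup>2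
     = g ys - g y' + D \<bullet> D / (2 * l)
       + \<mu> / 2 * (u \<bullet> u + 2 * (p - 1) * (u \<bullet> v) + (p - 1)\<^sup>2 * (v \<bullet> v))
       + 1 / p * (u \<bullet> D) + (1 - 1 / p) * (v \<bullet> D)"
    unfolding c c_def[symmetric] distrib_left[of "1 / p"] vD by simp
  also have "\<dots> \<le> g ys - g w
       + \<mu> / 2 * (u \<bullet> u + 2 * (p - 1) * (u \<bullet> v) + (p - 1)\<^sup>2 * (v \<bullet> v))
       + 1 / p * (g w - g ys - \<mu> / 2 * (u \<bullet> u)) + (1 - 1 / p) * (g w - g y)"
    using 1 2 3 p1 mu by (intro add_mono mult_left_mono) auto
  \<comment> \<open>The \<open>u \<bullet> u\<close> and \<open>u \<bullet> v\<close> terms agree;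
    the coefficients of \<open>v \<bullet> v\<close> differ by
    \<open>(p - 1)^2 - p * (p - 1) = - (p - 1)\<close>.\<close>
  also have "\<dots> = (1 - 1 / p) * (g ys - g y + \<mu> / 2 * (norm (u + p *\<^sub>R v))\<^sup>2) - \<mu> / 2 * (p - 1) * (v \<bullet> v)"
    using p1 unfolding power2_norm_eq_inner
    by (simp add: inner_add_left inner_add_right inner_commute divide_simps)
      (simp add: algebra_simps power2_eq_square)
  also have "\<dots> \<le> (1 - 1 / p) * (g ys - g y + \<mu> / 2 * (norm (u + p *\<^sub>R v))\<^sup>2)"
    using mu p1 by simp
  finally show ?thesis unfolding z z' .
qed

lemma nag_lyapunov:
  assumes "p = sqrt (l / \<mu>)" and "nag g (1 / l) ((p - 1) / (p + 1)) y0 k = (y, w)"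
  shows "g ys - g y + \<mu> / 2 * (norm (w + p *\<^sub>R (w - y) - ys))\<^sup>2
    \<le> (1 - 1 / p) ^ k * (g ys - g y0 + \<mu> / 2 * (norm (y0 - ys))\<^sup>2)"
  using assms(2)
proof (induction k arbitrary: y w)
  case (Suc k)
  obtain y1 w1 where yw: "nag g (1 / l) ((p - 1) / (p + 1)) y0 k = (y1, w1)" by fastforce
  have p1: "1 \<le> p" using mu mu_le by (simp add: assms(1))
  have "g ys - g y + \<mu> / 2 * (norm (w + p *\<^sub>R (w - y) - ys))\<^sup>2
      \<le> (1 - 1 / p) * (g ys - g y1 + \<mu> / 2 * (norm (w1 + p *\<^sub>R (w1 - y1) - ys))\<^sup>2)"
    by (rule nag_lyapunov_step) (use Suc.prems yw assms(1) in \<open>auto simp: Let_def\<close>)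
  also have "\<dots> \<le> (1 - 1 / p) * ((1 - 1 / p) ^ k * (g ys - g y0 + \<mu> / 2 * (norm (y0 - ys))\<^sup>2))"
    using p1 by (intro mult_left_mono Suc.IH yw) auto
  finally show ?case by simp
qed simp

text \<open>The Lyapunov function dominates \<open>\<mu> / 2\<close> times the squared error and
  starts below \<open>(l + \<mu>) / 2\<close> times the initial one; the quotient gives
  \<open>l / \<mu> + 1\<close>.\<close>

lemma nag_error:
  "(norm (fst (nag g (1 / l) ((sqrt (l / \<mu>) - 1) / (sqrt (l / \<mu>) + 1)) y0 k) - ys))\<^sup>2
    \<le> (l / \<mu> + 1) * exp (- (k / sqrt (l / \<mu>))) * (norm (y0 - ys))\<^sup>2"
proof -
  define p where "p = sqrt (l / \<mu>)"
  obtain y w where yw: "nag g (1 / l) ((p - 1) / (p + 1)) y0 k = (y, w)" by fastforce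
  have p1: "1 \<le> p" using mu mu_le by (simp add: p_def)
  have "(1 - 1 / p) ^ k \<le> exp (- (1 / p)) ^ k"
    using p1 exp_ge_add_one_self[of "- (1 / p)"] by (intro power_mono) auto
  also have "\<dots> = exp (- (k / p))" by (simp flip: exp_of_nat_mult)
  finally have rate: "(1 - 1 / p) ^ k \<le> exp (- (k / p))" .
  have init: "g ys - g y0 \<le> l / 2 * (norm (y0 - ys))\<^sup>2"
    using lower[of ys y0] by (simp add: grad_max)
  have "\<mu> / 2 * (norm (y - ys))\<^sup>2 \<le> g ys - g y"
    using upper[of y ys] by (simp add: grad_max)
  also have "\<dots> \<le> g ys - g y + \<mu> / 2 * (norm (w + p *\<^sub>R (w - y) - ys))\<^sup>2"
    using mu by simp
  also have "\<dots> \<le> (1 - 1 / p) ^ k * (g ys - g y0 + \<mu> / 2 * (norm (y0 - ys))\<^sup>2)"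
    by (rule nag_lyapunov[OF p_def yw])
  also have "\<dots> \<le> exp (- (k / p)) * (l / 2 * (norm (y0 - ys))\<^sup>2 + \<mu> / 2 * (norm (y0 - ys))\<^sup>2)"
    using rate init maximum[of y0] mu by (intro mult_mono add_mono) auto
  finally show ?thesis using mu yw by (simp add: p_def[symmetric] field_simps)
qed

text \<open>\<open>d\<close> only has to dominate the initial distance, so a computable bound can
  stand in for it. Doubling the logarithm matches the square in \<open>nag_error\<close>.\<close>

lemma nag_accuracy:
  assumes A: "0 < A" and dist: "norm (y0 - ys) \<le> d"
    and k: "2 * sqrt (l / \<mu>) * ln (sqrt (l / \<mu> + 1) * d / A) \<le> k"
  shows "norm (fst (nag g (1 / l) ((sqrt (l / \<mu>) - 1) / (sqrt (l / \<mu>) + 1)) y0 k) - ys) \<le> A"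
    (is "norm (?y - ys) \<le> A")
proof (cases "d = 0")
  \<comment> \<open>Here \<open>ln 0 = 0\<close> makes the condition on \<open>k\<close> empty, but
    the iteration starts at \<open>ys\<close> and stays there.\<close>
  case True
  then show ?thesis using nag_error[of y0 k] dist A by simp
next
  case False
  then have d: "0 < d" using dist norm_ge_zero[of "y0 - ys"] by linarith
  define p where "p = sqrt (l / \<mu>)"
  have p1: "1 \<le> p" and pp: "l / \<mu> = p\<^sup>2" using mu mu_le by (simp_all add: p_def)
  have X: "0 < sqrt (p\<^sup>2 + 1) * d / A" using d A by (simp add: add_nonneg_pos)
  have "2 * ln (sqrt (p\<^sup>2 + 1) * d / A) \<le> k / p"
    using k p1 unfolding p_def[symmetric] pp by (simp add: field_simps)
  then have "ln ((sqrt (p\<^sup>2 + 1) * d / A)\<^sup>2) \<le> k / p"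
    using X by (simp add: ln_realpow)
  then have "(sqrt (p\<^sup>2 + 1) * d / A)\<^sup>2 \<le> exp (k / p)"
    using X by (metis exp_le_cancel_iff exp_ln zero_less_power)
  then have *: "(p\<^sup>2 + 1) * d\<^sup>2 \<le> exp (k / p) * A\<^sup>2"
    using A by (simp add: power_divide power_mult_distrib divide_le_eq)
  have "(norm (?y - ys))\<^sup>2 \<le> (p\<^sup>2 + 1) * exp (- (k / p)) * (norm (y0 - ys))\<^sup>2"
    using nag_error[of y0 k] p1 unfolding p_def[symmetric] pp by simp
  also have "\<dots> \<le> (p\<^sup>2 + 1) * exp (- (k / p)) * d\<^sup>2"
    using dist by (intro mult_left_mono power_mono) auto
  also have "\<dots> = exp (- (k / p)) * ((p\<^sup>2 + 1) * d\<^sup>2)" by simp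
  also have "\<dots> \<le> exp (- (k / p)) * (exp (k / p) * A\<^sup>2)" by (intro mult_left_mono *) auto
  also have "\<dots> = A\<^sup>2" by (simp add: exp_minus)
  finally show ?thesis using A by (simp add: power2_le_iff_abs_le)
qed

end

section \<open>The primal function\<close>

text \<open>The path moves \<open>x\<close> first and \<open>y\<close> second, so only partial
  derivatives occur. The shift of the base point of \<open>Fy\<close> costs
  \<open>L * norm u * norm v\<close>, which completes the square.\<close>

lemma partial_lipschitz_remainder:
  fixes F :: "'a::real_normed_vector \<Rightarrow> 'b::real_normed_vector \<Rightarrow> 'c::real_normed_vector"
  assumes Fx: "\<And>x y. ((\<lambda>x. F x y) has_derivative Fx x y) (at x)"
    and Fy: "\<And>x y. ((\<lambda>y. F x y) has_derivative Fy x y) (at y)"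
    and lip_x: "\<And>x y x' y' h. norm (Fx x' y' h - Fx x y h) \<le> L * norm ((x', y') - (x, y)) * norm h"
    and lip_y: "\<And>x y x' y' h. norm (Fy x' y' h - Fy x y h) \<le> L * norm ((x', y') - (x, y)) * norm h"
  shows "norm (F (x + u) (y + v) - F x y - Fx x y u - Fy x y v) \<le> L / 2 * (norm u + norm v)\<^sup>2"
proof -
  have 1: "norm (F (x + u) y - F x y - Fx x y u) \<le> L / 2 * (norm u)\<^sup>2"
    by (rule Taylor_lipschitz[where F = "\<lambda>x. F x y" and F' = "\<lambda>x. Fx x y", OF Fx])
      (use lip_x[of _ y _ x y] in \<open>simp add: norm_Pair\<close>)
  have 2: "norm (F (x + u) (y + v) - F (x + u) y - Fy (x + u) y v) \<le> L / 2 * (norm v)\<^sup>2"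
    by (rule Taylor_lipschitz[where F = "F (x + u)" and F' = "Fy (x + u)", OF Fy])
      (use lip_y[of "x + u" _ _ "x + u" y] in \<open>simp add: norm_Pair\<close>)
  have 3: "norm (Fy (x + u) y v - Fy x y v) \<le> L * norm u * norm v"
    using lip_y[of "x + u" y v x y] by (simp add: norm_Pair)
  have "norm (F (x + u) (y + v) - F x y - Fx x y u - Fy x y v)
      = norm ((F (x + u) y - F x y - Fx x y u)
        + ((F (x + u) (y + v) - F (x + u) y - Fy (x + u) y v) + (Fy (x + u) y v - Fy x y v)))"
    by (rule arg_cong[where f = norm]) simp
  also have "\<dots> \<le> L / 2 * (norm u)\<^sup>2 + (L / 2 * (norm v)\<^sup>2 + L * norm u * norm v)"
    by (intro norm_triangle_mono 1 2 3)
  also have "\<dots> = L / 2 * (norm u + norm v)\<^sup>2"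
    by (simp add: power2_eq_square algebra_simps)
  finally show ?thesis .
qed

text \<open>An expansive square matrix has trivial kernel, hence is invertible, and the inverse
  contracts by \<open>1 / \<mu>\<close>.\<close>

lemma matrix_inv_expansive:
  fixes M :: "real^'m^'m"
  assumes mu: "0 < \<mu>" and expansive: "\<And>v. \<mu> * norm v \<le> norm (M *v v)"
  shows "M *v (matrix_inv M *v w) = w" and "matrix_inv M *v (M *v w) = w"
    and "norm (matrix_inv M *v w) \<le> norm w / \<mu>"
proof -
  have "M *v v = 0 \<Longrightarrow> v = 0" for v
    using expansive[of v] mu by (simp add: mult_le_0_iff)
  then have "invertible M"
    by (simp add: invertible_left_inverse matrix_left_invertible_ker)
  then have inv: "M ** matrix_inv M = mat 1 \<and> matrix_inv M ** M = mat 1"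
    unfolding invertible_def matrix_inv_def by (rule someI_ex)
  then show 1: "M *v (matrix_inv M *v w) = w" and "matrix_inv M *v (M *v w) = w"
    by (simp_all add: matrix_vector_mul_assoc)
  show "norm (matrix_inv M *v w) \<le> norm w / \<mu>"
    using expansive[of "matrix_inv M *v w"] mu unfolding 1 by (simp add: field_simps)
qed

lemma lipschitz_matrix_mult:
  assumes "lipschitz_matrix \<rho> M"
  shows "norm (M x y *v v - M x' y' *v v) \<le> \<rho> * norm ((x, y) - (x', y')) * norm v"
proof -
  have "norm ((M x y - M x' y') *v v) \<le> spectral_norm (M x y - M x' y') * norm v"
    unfolding spectral_norm_def by (rule onorm) simp
  also have "\<dots> \<le> \<rho> * norm ((x, y) - (x', y')) * norm v"
    using assms unfolding lipschitz_matrix_def by (intro mult_right_mono) auto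
  finally show ?thesis by (simp add: matrix_vector_mult_diff_rdistrib)
qed

locale minimax =
  fixes f :: "(real^'n) \<times> (real^'m) \<Rightarrow> real" and l \<mu> \<rho> Pstar :: real
  assumes mu: "0 < \<mu>" and rho: "0 < \<rho>" and assumptions: "minimax_assumptions f l \<mu> \<rho> Pstar"
begin

abbreviation "ys \<equiv> y_star f"
abbreviation "P \<equiv> primal f"
abbreviation "\<kappa> \<equiv> kappa l \<mu>"
abbreviation "grad_P x \<equiv> grad_x f x (ys x)"
abbreviation "hess_P x \<equiv> schur_hess f x (ys x)"

section \<open>Partial gradients and the inner maximiser\<close>

lemma GDERIV_f: "GDERIV f z :> grad f z"
  using assumptions unfolding minimax_assumptions_def by (blast intro: GDERIV_grad)

lemma grad_lipschitz: "norm (grad f z - grad f z') \<le> l * norm (z - z')"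
  using assumptions unfolding minimax_assumptions_def by blast

lemma strongly_concave_f: "strongly_concave \<mu> (\<lambda>y. f (x, y))"
  using assumptions unfolding minimax_assumptions_def by blast

lemma GDERIV_x: "GDERIV (\<lambda>u. f (u, y)) x :> fst (grad f (x, y))"
proof -
  have "((\<lambda>u. (u, y)) has_derivative (\<lambda>h. (h, 0))) (at x)"
    by (auto intro!: derivative_eq_intros)
  from diff_chain_at[OF this GDERIV_f[unfolded gderiv_def]] show ?thesis
    by (simp add: gderiv_def o_def inner_prod_def)
qed

lemma GDERIV_y: "GDERIV (\<lambda>v. f (x, v)) y :> snd (grad f (x, y))"
proof -
  have "((\<lambda>v. (x, v)) has_derivative (\<lambda>h. (0, h))) (at y)"
    by (auto intro!: derivative_eq_intros)
  from diff_chain_at[OF this GDERIV_f[unfolded gderiv_def]] show ?thesis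
    by (simp add: gderiv_def o_def inner_prod_def)
qed

lemma grad_x_eq: "grad_x f x y = fst (grad f (x, y))"
  unfolding grad_x_def by (rule GDERIV_imp_grad[OF GDERIV_x])

lemma grad_y_eq: "grad_y f x y = snd (grad f (x, y))"
  unfolding grad_y_def by (rule GDERIV_imp_grad[OF GDERIV_y])

lemma grad_x_lipschitz: "norm (grad_x f x y - grad_x f x' y') \<le> l * norm ((x, y) - (x', y'))"
  unfolding grad_x_eq fst_diff[symmetric] by (rule order_trans[OF _ grad_lipschitz]) (metis norm_fst_le prod.collapse)

lemma grad_y_lipschitz: "norm (grad_y f x y - grad_y f x' y') \<le> l * norm ((x, y) - (x', y'))"
  unfolding grad_y_eq snd_diff[symmetric] by (rule order_trans[OF _ grad_lipschitz]) (metis norm_snd_le prod.collapse)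

lemma f_remainder: "\<bar>f (z + d) - f z - d \<bullet> grad f z\<bar> \<le> l / 2 * (norm d)\<^sup>2"
proof -
  have "norm (f (z + d) - f z - d \<bullet> grad f z) \<le> l / 2 * (norm d)\<^sup>2"
  proof (rule Taylor_lipschitz)
    show "(f has_derivative (\<lambda>d. d \<bullet> grad f z)) (at z)" for z
      using GDERIV_f by (simp add: gderiv_def)
    show "norm (d \<bullet> grad f z' - d \<bullet> grad f z) \<le> l * norm (z' - z) * norm d" for z' d
      using Cauchy_Schwarz_ineq2[of d "grad f z' - grad f z"]
        mult_left_mono[OF grad_lipschitz[of z' z] norm_ge_zero[of d]]
      by (simp add: inner_diff_right mult_ac)
  qed
  then show ?thesis by simp
qed

lemma f_upper: "f (x, y') \<le> f (x, y) + grad_y f x y \<bullet> (y' - y) - \<mu> / 2 * (norm (y' - y))\<^sup>2"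
  using strongly_concave_gradient[OF strongly_concave_f GDERIV_y] by (simp add: grad_y_eq)

lemma f_lower: "f (x, y') \<ge> f (x, y) + grad_y f x y \<bullet> (y' - y) - l / 2 * (norm (y' - y))\<^sup>2"
  using abs_le_D2[OF f_remainder[of "(x, y)" "(0, y' - y)"]]
  by (simp add: grad_y_eq inner_prod_def norm_Pair inner_commute)

text \<open>Both quadratic bounds apply to the same nonzero displacement, here the all-ones
  vector.\<close>

lemma mu_le_l: "\<mu> \<le> l"
proof -
  have "- l / 2 * (norm (1 :: real^'m))\<^sup>2 \<le> - \<mu> / 2 * (norm (1 :: real^'m))\<^sup>2"
    using order_trans[OF f_lower[of 0 0 1] f_upper[of 0 1 0]] by simp
  moreover have "0 < (norm (1 :: real^'m))\<^sup>2" by (simp add: vec_eq_iff)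
  ultimately show ?thesis by simp
qed

lemma l_pos: "0 < l" using mu mu_le_l by simp

lemma kappa_ge_1: "1 \<le> \<kappa>" using mu mu_le_l by (simp add: kappa_def)

text \<open>\<open>arg_max\<close> is a choice operator, so its defining property rests on the
  existence of a maximiser.\<close>

lemma y_star_maximum: "f (x, y) \<le> f (x, ys x)"
proof -
  have "continuous_on UNIV (\<lambda>y. f (x, y))"
    using GDERIV_y unfolding gderiv_def
    by (metis continuous_at_imp_continuous_on has_derivative_continuous)
  then have "\<exists>m. \<forall>y. f (x, y) \<le> f (x, m)"
    using f_upper[of x _ 0] by (intro strongly_concave_attains_max[OF mu]) auto
  then have "\<exists>m. is_arg_max (\<lambda>y. f (x, y)) (\<lambda>_. True) m"
    by (simp add: is_arg_max_linorder)
  then have "is_arg_max (\<lambda>y. f (x, y)) (\<lambda>_. True) (ys x)"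
    unfolding y_star_def arg_max_def by (rule someI_ex)
  then show ?thesis by (simp add: is_arg_max_linorder)
qed

lemma strongly_concave_smooth_f: "strongly_concave_smooth (\<lambda>y. f (x, y)) l \<mu> (ys x)"
  using mu mu_le_l f_upper f_lower y_star_maximum
  by unfold_locales (auto simp: grad_y_def)

lemma primal_eq: "P x = f (x, ys x)"
  unfolding primal_def by (rule cSup_eq_maximum) (use y_star_maximum in auto)

lemma Pstar_le: "Pstar \<le> P x"
  using assumptions unfolding minimax_assumptions_def by blast

lemma grad_y_star: "grad_y f x (ys x) = 0"
  using strongly_concave_smooth.grad_max[OF strongly_concave_smooth_f] by (simp add: grad_y_def)

lemma grad_y_monotone: "(grad_y f x y - grad_y f x y') \<bullet> (y - y') \<le> - \<mu> * (norm (y - y'))\<^sup>2"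
  using f_upper[of x y y'] f_upper[of x y' y]
  by (simp add: inner_diff_left inner_diff_right norm_minus_commute)

text \<open>Strong monotonicity at \<open>x'\<close> between the two maximisers:
  \<open>grad_y\<close> vanishes at each maximiser for its own argument, so what remains is a change
  of \<open>x\<close> alone.\<close>

lemma y_star_lipschitz: "norm (ys x - ys x') \<le> \<kappa> * norm (x - x')"
proof (cases "ys x = ys x'")
  case False
  define d where "d = ys x - ys x'"
  have "\<mu> * (norm d)\<^sup>2 \<le> (grad_y f x (ys x) - grad_y f x' (ys x)) \<bullet> d"
    using grad_y_monotone[of x' "ys x" "ys x'"] by (simp add: d_def grad_y_star)
  also have "\<dots> \<le> norm (grad_y f x (ys x) - grad_y f x' (ys x)) * norm d"
    by (rule norm_cauchy_schwarz)
  also have "\<dots> \<le> l * norm (x - x') * norm d"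
    using grad_y_lipschitz[of x "ys x" x' "ys x"] by (intro mult_right_mono) (auto simp: norm_Pair)
  finally have "\<mu> * norm d \<le> l * norm (x - x')"
    using False by (simp add: d_def power2_eq_square)
  then show ?thesis using mu by (simp add: kappa_def d_def field_simps)
qed (use kappa_ge_1 in simp)

section \<open>Hessian blocks and their Schur complement\<close>

lemma has_derivative_hess:
  "((\<lambda>u. grad_x f u y) has_derivative (*v) (hess_xx f x y)) (at x)"
  "((\<lambda>v. grad_x f x v) has_derivative (*v) (hess_xy f x y)) (at y)"
  "((\<lambda>u. grad_y f u y) has_derivative (*v) (hess_yx f x y)) (at x)"
  "((\<lambda>v. grad_y f x v) has_derivative (*v) (hess_yy f x y)) (at y)"
  using assumptions unfolding hess_xx_def hess_xy_def hess_yx_def hess_yy_def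
  by (simp_all add: minimax_assumptions_def twice_partially_differentiable_def flip: jacobian_works)

lemma hess_lipschitz:
  "norm (hess_xx f x y *v v - hess_xx f x' y' *v v) \<le> \<rho> * norm ((x, y) - (x', y')) * norm v"
  "norm (hess_xy f x y *v w - hess_xy f x' y' *v w) \<le> \<rho> * norm ((x, y) - (x', y')) * norm w"
  "norm (hess_yx f x y *v v - hess_yx f x' y' *v v) \<le> \<rho> * norm ((x, y) - (x', y')) * norm v"
  "norm (hess_yy f x y *v w - hess_yy f x' y' *v w) \<le> \<rho> * norm ((x, y) - (x', y')) * norm w"
  using assumptions unfolding minimax_assumptions_def by (blast intro: lipschitz_matrix_mult)+

lemma hess_bound:
  "norm (hess_xx f x y *v v) \<le> l * norm v"
  "norm (hess_xy f x y *v w) \<le> l * norm w"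
  "norm (hess_yx f x y *v v) \<le> l * norm v"
  using grad_x_lipschitz[of _ y x y] grad_x_lipschitz[of x _ x y] grad_y_lipschitz[of _ y x y]
  by (auto intro!: norm_derivative_le_lipschitz has_derivative_hess simp: norm_Pair)

lemma hess_yy_expansive: "\<mu> * norm v \<le> norm (hess_yy f x y *v v)"
proof (rule norm_derivative_ge_expansive[OF has_derivative_hess(4)])
  fix z
  show "\<mu> * norm (z - y) \<le> norm (grad_y f x z - grad_y f x y)"
  proof (cases "z = y")
    case False
    have "\<mu> * (norm (z - y))\<^sup>2 \<le> - ((grad_y f x z - grad_y f x y) \<bullet> (z - y))"
      using grad_y_monotone[of x z y] by simp
    also have "\<dots> \<le> norm (grad_y f x z - grad_y f x y) * norm (z - y)"
      using Cauchy_Schwarz_ineq2[of "grad_y f x z - grad_y f x y" "z - y"] by (simp add: abs_le_iff)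
    finally show ?thesis using False by (simp add: power2_eq_square)
  qed simp
qed

lemmas hess_yy_inv = matrix_inv_expansive[OF mu hess_yy_expansive]

lemma schur_hess_mult:
  "schur_hess f x y *v v
    = hess_xx f x y *v v - hess_xy f x y *v (matrix_inv (hess_yy f x y) *v (hess_yx f x y *v v))"
  by (simp add: schur_hess_def matrix_vector_mult_diff_rdistrib matrix_vector_mul_assoc matrix_mul_assoc)

lemma schur_hess_bound: "norm (schur_hess f x y *v v) \<le> L1 l \<mu> * norm v"
proof -
  let ?D = "matrix_inv (hess_yy f x y)"
  have "norm (?D *v (hess_yx f x y *v v)) \<le> l * norm v / \<mu>"
    using mu by (intro order_trans[OF hess_yy_inv(3)] divide_right_mono hess_bound) auto
  then have "norm (hess_xy f x y *v (?D *v (hess_yx f x y *v v))) \<le> l * (l * norm v / \<mu>)"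
    using l_pos by (intro order_trans[OF hess_bound(2)] mult_left_mono) auto
  then have "norm (schur_hess f x y *v v) \<le> l * norm v + l * (l * norm v / \<mu>)"
    unfolding schur_hess_mult
    by (intro order_trans[OF norm_triangle_ineq4] add_mono hess_bound)
  then show ?thesis by (simp add: L1_def kappa_def algebra_simps)
qed

text \<open>The inverses are never subtracted from each other: \<open>w - w'\<close> is
  \<open>D'\<close> applied to the change of the linear system solved by \<open>w\<close>. The
  constants add up to \<open>(1 + \<kappa>) + \<kappa> * (1 + \<kappa>) = (1 +
  \<kappa>)^2\<close>.\<close>

lemma schur_hess_lipschitz:
  "norm (schur_hess f x y *v v - schur_hess f x' y' *v v) \<le> LH l \<mu> \<rho> * norm ((x, y) - (x', y')) * norm v"
proof -
  define d where "d = norm ((x, y) - (x', y'))"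
  define D D' where "D = matrix_inv (hess_yy f x y)" and "D' = matrix_inv (hess_yy f x' y')"
  define w w' where "w = D *v (hess_yx f x y *v v)" and "w' = D' *v (hess_yx f x' y' *v v)"
  have w: "norm w \<le> \<kappa> * norm v"
    unfolding w_def D_def using divide_right_mono[OF hess_bound(3)[of x y v], of \<mu>] mu
    by (intro order_trans[OF hess_yy_inv(3)]) (simp add: kappa_def)
  have "hess_yy f x' y' *v w' = hess_yx f x' y' *v v" "hess_yy f x y *v w = hess_yx f x y *v v"
    by (simp_all add: w_def w'_def D_def D'_def hess_yy_inv)
  then have "w - w' = D' *v ((hess_yx f x y *v v - hess_yx f x' y' *v v)
      - (hess_yy f x y *v w - hess_yy f x' y' *v w))"
    by (simp add: D'_def w'_def hess_yy_inv(2) matrix_vector_mult_diff_distrib)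
  also have "norm \<dots> \<le> norm ((hess_yx f x y *v v - hess_yx f x' y' *v v)
      - (hess_yy f x y *v w - hess_yy f x' y' *v w)) / \<mu>"
    unfolding D'_def by (rule hess_yy_inv(3))
  also have "\<dots> \<le> (\<rho> * d * norm v + \<rho> * d * norm w) / \<mu>"
    using mu unfolding d_def
    by (intro divide_right_mono order_trans[OF norm_triangle_ineq4] add_mono hess_lipschitz) auto
  also have "\<dots> \<le> (\<rho> * d * norm v + \<rho> * d * (\<kappa> * norm v)) / \<mu>"
    using mu rho w unfolding d_def
    by (intro divide_right_mono add_left_mono mult_left_mono) auto
  finally have ww': "norm (w - w') \<le> (\<rho> * d * norm v + \<rho> * d * (\<kappa> * norm v)) / \<mu>" .
  have "schur_hess f x y *v v - schur_hess f x' y' *v v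
      = (hess_xx f x y *v v - hess_xx f x' y' *v v)
        - ((hess_xy f x y *v w - hess_xy f x' y' *v w) + hess_xy f x' y' *v (w - w'))"
    by (simp add: schur_hess_mult w_def w'_def D_def D'_def matrix_vector_mult_diff_distrib)
  also have "norm \<dots> \<le> \<rho> * d * norm v + (\<rho> * d * norm w + l * norm (w - w'))"
    unfolding d_def
    by (intro order_trans[OF norm_triangle_ineq4] order_trans[OF norm_triangle_ineq] add_mono
        hess_lipschitz hess_bound)
  also have "\<dots> \<le> \<rho> * d * norm v + (\<rho> * d * (\<kappa> * norm v)
      + l * ((\<rho> * d * norm v + \<rho> * d * (\<kappa> * norm v)) / \<mu>))"
    using rho l_pos w ww' unfolding d_def by (intro add_mono mult_left_mono) auto
  also have "\<dots> = LH l \<mu> \<rho> * d * norm v"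
    using mu by (simp add: LH_def kappa_def power2_eq_square field_simps)
  finally show ?thesis by (simp add: d_def)
qed

section \<open>Gradient and second-order expansion of the primal function\<close>

lemma y_star_graph_lipschitz: "norm ((x, ys x) - (x', ys x')) \<le> (1 + \<kappa>) * norm (x - x')"
  using norm_Pair_le[of "x - x'" "ys x - ys x'"] y_star_lipschitz[of x x'] by (simp add: algebra_simps)

lemma grad_P_lipschitz: "norm (grad_P x - grad_P x') \<le> L1 l \<mu> * norm (x - x')"
  using order_trans[OF grad_x_lipschitz[of x "ys x" x' "ys x'"]
      mult_left_mono[OF y_star_graph_lipschitz]] l_pos
  by (simp add: L1_def mult_ac add.commute)

lemma grad_remainder:
  "norm (grad_x f (x + u) (y + v) - grad_x f x y - hess_xx f x y *v u - hess_xy f x y *v v)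
    \<le> \<rho> / 2 * (norm u + norm v)\<^sup>2"
  "norm (grad_y f (x + u) (y + v) - grad_y f x y - hess_yx f x y *v u - hess_yy f x y *v v)
    \<le> \<rho> / 2 * (norm u + norm v)\<^sup>2"
  by (intro partial_lipschitz_remainder has_derivative_hess hess_lipschitz)+

lemma grad_P_remainder: "norm (grad_P (x + s) - grad_P x - hess_P x *v s) \<le> L2 l \<mu> \<rho> / 2 * (norm s)\<^sup>2"
proof -
  define v where "v = ys (x + s) - ys x"
  define D where "D = matrix_inv (hess_yy f x (ys x))"
  define w where "w = D *v (hess_yx f x (ys x) *v s)"
  have v: "norm v \<le> \<kappa> * norm s"
    using y_star_lipschitz[of "x + s" x] by (simp add: v_def)
  have sv: "\<rho> / 2 * (norm s + norm v)\<^sup>2 \<le> \<rho> / 2 * ((1 + \<kappa>)\<^sup>2 * (norm s)\<^sup>2)"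
    using rho v unfolding power_mult_distrib[symmetric]
    by (intro mult_left_mono power_mono) (auto simp: algebra_simps)
  \<comment> \<open>Both zeros are \<open>grad_y\<close> at a maximiser. Hence \<open>v\<close>
    solves the linearised optimality condition up to the remainder, and \<open>v + w\<close> is
    quadratically small.\<close>
  have "norm (0 - 0 - hess_yx f x (ys x) *v s - hess_yy f x (ys x) *v v) \<le> \<rho> / 2 * (norm s + norm v)\<^sup>2"
    using grad_remainder(2)[of x s "ys x" v] by (simp add: v_def grad_y_star)
  moreover have "v + w = D *v (- (0 - 0 - hess_yx f x (ys x) *v s - hess_yy f x (ys x) *v v))"
    by (simp add: w_def D_def hess_yy_inv(2) matrix_vector_right_distrib)
  ultimately have vw: "norm (v + w) \<le> \<rho> / 2 * ((1 + \<kappa>)\<^sup>2 * (norm s)\<^sup>2) / \<mu>"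
    unfolding D_def
    by (smt (verit) hess_yy_inv(3) norm_minus_cancel sv divide_right_mono mu)
  have "grad_P (x + s) - grad_P x - hess_P x *v s
      = (grad_x f (x + s) (ys x + v) - grad_x f x (ys x) - hess_xx f x (ys x) *v s - hess_xy f x (ys x) *v v)
        + hess_xy f x (ys x) *v (v + w)"
    by (simp add: schur_hess_mult w_def D_def v_def matrix_vector_right_distrib)
  also have "norm \<dots> \<le> \<rho> / 2 * (norm s + norm v)\<^sup>2 + l * norm (v + w)"
    by (intro order_trans[OF norm_triangle_ineq] add_mono grad_remainder hess_bound)
  also have "\<dots> \<le> \<rho> / 2 * ((1 + \<kappa>)\<^sup>2 * (norm s)\<^sup>2) + l * (\<rho> / 2 * ((1 + \<kappa>)\<^sup>2 * (norm s)\<^sup>2) / \<mu>)"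
    using l_pos by (intro add_mono sv mult_left_mono vw) auto
  also have "\<dots> = L2 l \<mu> \<rho> / 2 * (norm s)\<^sup>2"
  proof -
    have *: "l * (Z / \<mu>) = \<kappa> * Z" for Z by (simp add: kappa_def)
    show ?thesis unfolding * by (simp add: L2_def power2_eq_square power3_eq_cube algebra_simps)
  qed
  finally show ?thesis .
qed

text \<open>The \<open>y\<close>-gradient vanishes at the maximiser, so the displacement of \<open>y\<^sup>*\<close> enters only quadratically.\<close>

lemma GDERIV_P: "GDERIV P x :> grad_P x"
  unfolding gderiv_def
proof (rule has_derivative_quadratic_remainder)
  show "bounded_linear (\<lambda>h. h \<bullet> grad_P x)" by (rule bounded_linear_inner_left)
  fix h
  define d where "d = ys (x + h) - ys x"
  have "\<bar>f ((x, ys x) + (h, d)) - f (x, ys x) - (h, d) \<bullet> grad f (x, ys x)\<bar> \<le> l / 2 * (norm (h, d))\<^sup>2"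
    by (rule f_remainder)
  also have "\<dots> \<le> l / 2 * ((1 + \<kappa>) * norm h)\<^sup>2"
    using y_star_graph_lipschitz[of "x + h" x] l_pos
    by (intro mult_left_mono power_mono) (auto simp: d_def)
  finally show "norm (P (x + h) - P x - h \<bullet> grad_P x) \<le> l / 2 * (1 + \<kappa>)\<^sup>2 * (norm h)\<^sup>2"
    using grad_y_star[of x] by (simp add: primal_eq d_def grad_x_eq grad_y_eq inner_prod_def power_mult_distrib)
qed

lemma P_cubic_upper:
  "P (x + s) \<le> P x + grad_P x \<bullet> s + 1/2 * (s \<bullet> (hess_P x *v s)) + L2 l \<mu> \<rho> / 6 * norm s ^ 3"
  using abs_le_D1[OF Taylor_second_order[where P = P and g = "\<lambda>x. grad_P x" and H = "(*v) (hess_P x)",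
      OF GDERIV_P grad_P_remainder matrix_vector_mult_scaleR, of s]]
  by simp

lemma L1_pos: "0 < L1 l \<mu>"
  using l_pos kappa_ge_1 by (simp add: L1_def)

text \<open>A gradient step of length \<open>1 / L1\<close> lowers \<open>P\<close> by
  \<open>norm (grad_P x) ^ 2 / (2 * L1)\<close>, yet \<open>P\<close> stays above
  \<open>Pstar\<close>.\<close>

lemma grad_P_bound: "(norm (grad_P x))\<^sup>2 \<le> 2 * L1 l \<mu> * (P x - Pstar)"
proof -
  define s where "s = - (1 / L1 l \<mu>) *\<^sub>R grad_P x"
  have "norm (P (x + s) - P x - s \<bullet> grad_P x) \<le> L1 l \<mu> / 2 * (norm s)\<^sup>2"
  proof (rule Taylor_lipschitz)
    show "(P has_derivative (\<lambda>s. s \<bullet> grad_P z)) (at z)" for z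
      using GDERIV_P by (simp add: gderiv_def)
    show "norm (d \<bullet> grad_P z - d \<bullet> grad_P x) \<le> L1 l \<mu> * norm (z - x) * norm d" for z d
      using Cauchy_Schwarz_ineq2[of d "grad_P z - grad_P x"]
        mult_left_mono[OF grad_P_lipschitz[of z x] norm_ge_zero[of d]]
      by (simp add: inner_diff_right mult_ac)
  qed
  then have "Pstar \<le> P x + s \<bullet> grad_P x + L1 l \<mu> / 2 * (norm s)\<^sup>2"
    using Pstar_le[of "x + s"] unfolding real_norm_def by linarith
  moreover have "s \<bullet> grad_P x + L1 l \<mu> / 2 * (norm s)\<^sup>2 = - (norm (grad_P x))\<^sup>2 / (2 * L1 l \<mu>)"
    using L1_pos by (simp add: s_def dot_square_norm power2_eq_square field_simps)
  ultimately have "(norm (grad_P x))\<^sup>2 / (2 * L1 l \<mu>) \<le> P x - Pstar"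
    by linarith
  then show ?thesis using L1_pos by (simp add: field_simps)
qed

end

section \<open>Trust-region steps with inexact derivatives\<close>

text \<open>\<open>E\<close> will be \<open>sqrt \<epsilon>\<close>, which turns all powers of the
  target accuracy into integer ones.\<close>

locale accurate = minimax f l \<mu> \<rho> Pstar
  for f :: "(real^'n) \<times> (real^'m) \<Rightarrow> real" and l \<mu> \<rho> Pstar :: real +
  fixes S A E :: real
  assumes S_def: "S = sqrt (L2 l \<mu> \<rho>)" and A_pos: "0 < A" and E_pos: "0 < E"
    and gradient_accuracy: "l * A \<le> S * E ^ 3 / (162 * L1 l \<mu>)"
    and hessian_accuracy: "LH l \<mu> \<rho> * A \<le> S * E / 54"
begin

lemma S_pos: "0 < S" and S_square: "S\<^sup>2 = L2 l \<mu> \<rho>"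
  using rho kappa_ge_1 by (simp_all add: S_def L2_def)

lemma LH_pos: "0 < LH l \<mu> \<rho>"
  using rho kappa_ge_1 by (simp add: LH_def)

text \<open>Since \<open>L2 * l = L1 * LH\<close>, Hessian accuracy is at the same time a second
  bound on the gradient error.\<close>

lemma gradient_accuracy': "l * A \<le> L1 l \<mu> * E / (54 * S)"
proof -
  have "S\<^sup>2 * (l * A) = L1 l \<mu> * (LH l \<mu> \<rho> * A)"
    unfolding S_square by (simp add: L1_def LH_def L2_def power2_eq_square power3_eq_cube algebra_simps)
  also have "\<dots> \<le> L1 l \<mu> * (S * E / 54)"
    using hessian_accuracy L1_pos by (intro mult_left_mono) auto
  finally show ?thesis using S_pos by (simp add: field_simps power2_eq_square)
qed

lemma accuracy_mono:
  assumes "E \<le> q"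
  shows "l * A \<le> S * q ^ 3 / (162 * L1 l \<mu>)" "l * A \<le> L1 l \<mu> * q / (54 * S)" "LH l \<mu> \<rho> * A \<le> S * q / 54"
proof -
  have "E ^ 3 \<le> q ^ 3" using assms E_pos by (intro power_mono) auto
  then have "S * E ^ 3 / (162 * L1 l \<mu>) \<le> S * q ^ 3 / (162 * L1 l \<mu>)"
    using S_pos L1_pos by (intro divide_right_mono mult_left_mono) auto
  with gradient_accuracy show "l * A \<le> S * q ^ 3 / (162 * L1 l \<mu>)" by simp
  have "L1 l \<mu> * E / (54 * S) \<le> L1 l \<mu> * q / (54 * S)" "S * E / 54 \<le> S * q / 54"
    using assms S_pos L1_pos by (auto intro!: divide_right_mono mult_left_mono)
  with gradient_accuracy' hessian_accuracy
  show "l * A \<le> L1 l \<mu> * q / (54 * S)" "LH l \<mu> \<rho> * A \<le> S * q / 54" by simp_all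
qed

text \<open>Geometric mean of the two bounds: it holds for every \<open>\<epsilon>\<close>, whereas
  \<open>\<epsilon>\<^sub>1 \<le> \<epsilon>\<^sup>3\<^sup>/\<^sup>2 / 162\<close> alone helps only for \<open>\<epsilon> \<le> 1\<close>.\<close>

lemma gradient_accuracy_quadratic:
  assumes "E \<le> q"
  shows "l * A \<le> 107 / 10000 * q\<^sup>2"
proof (rule power2_le_imp_le)
  have "(l * A) * (l * A) \<le> (S * q ^ 3 / (162 * L1 l \<mu>)) * (L1 l \<mu> * q / (54 * S))"
    using accuracy_mono[OF assms] l_pos A_pos assms E_pos S_pos L1_pos by (intro mult_mono) auto
  also have "\<dots> = q ^ 4 / 8748"
    using S_pos L1_pos by (simp add: field_simps eval_nat_numeral)
  \<comment> \<open>\<open>8748 = 162 * 54\<close>, and \<open>107/10000\<close> is just above the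
    root of its reciprocal.\<close>
  also have "\<dots> \<le> (107 / 10000)\<^sup>2 * q ^ 4"
    using mult_right_mono[of "1 / 8748" "(107 / 10000)\<^sup>2 :: real" "q ^ 4"]
    by (simp add: power2_eq_square)
  finally show "(l * A)\<^sup>2 \<le> (107 / 10000 * q\<^sup>2)\<^sup>2"
    by (simp add: power2_eq_square eval_nat_numeral mult_ac)
qed simp

lemma gradient_error:
  assumes "norm (y - ys x) \<le> A"
  shows "norm (grad_x f x y - grad_P x) \<le> l * A"
  using order_trans[OF grad_x_lipschitz[of x y x "ys x"] mult_left_mono[OF _ less_imp_le[OF l_pos]]] assms
  by (simp add: norm_Pair)

lemma hessian_error:
  assumes "norm (y - ys x) \<le> A"
  shows "norm (schur_hess f x y *v v - hess_P x *v v) \<le> LH l \<mu> \<rho> * A * norm v"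
proof -
  have "norm (schur_hess f x y *v v - hess_P x *v v) \<le> LH l \<mu> \<rho> * norm ((x, y) - (x, ys x)) * norm v"
    by (rule schur_hess_lipschitz)
  also have "\<dots> \<le> LH l \<mu> \<rho> * A * norm v"
    using assms LH_pos by (intro mult_right_mono mult_left_mono) (auto simp: norm_Pair)
  finally show ?thesis .
qed

lemma inexact_model:
  assumes "norm (y - ys x) \<le> A"
  shows "P (x + s) \<le> P x + (grad_x f x y \<bullet> s + 1/2 * (s \<bullet> (schur_hess f x y *v s)))
    + l * A * norm s + 1/2 * (LH l \<mu> \<rho> * A) * (norm s)\<^sup>2 + S\<^sup>2 / 6 * norm s ^ 3"
proof -
  have "grad_P x \<bullet> s - grad_x f x y \<bullet> s = - ((grad_x f x y - grad_P x) \<bullet> s)"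
    by (simp add: inner_diff_left)
  also have "\<dots> \<le> norm (grad_x f x y - grad_P x) * norm s"
    using Cauchy_Schwarz_ineq2[of "grad_x f x y - grad_P x" s] by linarith
  also have "\<dots> \<le> l * A * norm s"
    by (intro mult_right_mono gradient_error assms) auto
  finally have 1: "grad_P x \<bullet> s \<le> grad_x f x y \<bullet> s + l * A * norm s" by simp
  have "s \<bullet> (hess_P x *v s) - s \<bullet> (schur_hess f x y *v s)
      = - (s \<bullet> (schur_hess f x y *v s - hess_P x *v s))"
    by (simp add: inner_diff_right)
  also have "\<dots> \<le> norm s * norm (schur_hess f x y *v s - hess_P x *v s)"
    using Cauchy_Schwarz_ineq2[of s "schur_hess f x y *v s - hess_P x *v s"] by linarith
  also have "\<dots> \<le> norm s * (LH l \<mu> \<rho> * A * norm s)"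
    by (intro mult_left_mono hessian_error assms) auto
  finally have "s \<bullet> (hess_P x *v s) \<le> s \<bullet> (schur_hess f x y *v s) + LH l \<mu> \<rho> * A * (norm s)\<^sup>2"
    by (simp add: power2_eq_square mult_ac)
  with 1 show ?thesis using P_cubic_upper[of x s] unfolding S_square by simp
qed

text \<open>In units of \<open>q ^ 3 / (486 * S)\<close> the model contributes -6, the Hessian error
  1/2 and the cubic term 3, which leaves -5/2. The gradient error stays explicit because its best
  bound depends on the regime.\<close>

lemma boundary_step_decrease:
  assumes acc: "norm (y - ys x) \<le> A" and q: "E \<le> q"
    and model: "grad_x f x y \<bullet> s + 1/2 * (s \<bullet> (schur_hess f x y *v s)) \<le> - (1/8) * (8 * S / 9) * q * (norm s)\<^sup>2"
    and norm_s: "norm s = 1 / (3 * S) * q"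
  shows "P (x + s) \<le> P x - q * (5/2 * q\<^sup>2 - 162 * (l * A)) / (486 * S)"
proof -
  have "LH l \<mu> \<rho> * A * (norm s)\<^sup>2 \<le> S * q / 54 * (norm s)\<^sup>2"
    using accuracy_mono(3)[OF q] by (intro mult_right_mono) auto
  then have "P (x + s) \<le> P x - (S / 9) * q * (norm s)\<^sup>2
    + l * A * norm s + 1/2 * (S * q / 54 * (norm s)\<^sup>2) + S\<^sup>2 / 6 * norm s ^ 3"
    using inexact_model[OF acc, of s] model by simp
  also have "\<dots> = P x - q * (5/2 * q\<^sup>2 - 162 * (l * A)) / (486 * S)"
    unfolding norm_s using S_pos by (simp add: field_simps eval_nat_numeral)
  finally show ?thesis .
qed

text \<open>The residual condition bounds the step length from below, so the gradient error can be
  charged to the step. The three errors take the shares 5/108, 1/108 and 6/108 of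
  \<open>S * q * norm s ^ 2\<close>, together exactly the model decrease 1/9.\<close>

lemma interior_step_decrease:
  assumes acc: "norm (y - ys x) \<le> A" and q: "E < q" and q2: "q\<^sup>2 = norm (grad_x f x y)"
    and model: "grad_x f x y \<bullet> s + 1/2 * (s \<bullet> (schur_hess f x y *v s)) \<le> - (1/8) * (8 * S / 9) * q * (norm s)\<^sup>2"
    and norm_s: "norm s \<le> 1 / (3 * S) * q"
    and residual: "norm (schur_hess f x y *v s + (8 * S / 9 * q) *\<^sub>R s + grad_x f x y) \<le> 1/2 * q\<^sup>2"
  shows "P (x + s) \<le> P x"
proof -
  let ?n = "norm s" and ?e = "l * A"
  have q0: "0 < q" using q E_pos by simp
  have "q\<^sup>2 = norm ((schur_hess f x y *v s + (8 * S / 9 * q) *\<^sub>R s + grad_x f x y)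
      - (schur_hess f x y *v s + (8 * S / 9 * q) *\<^sub>R s))"
    using q2 by simp
  also have "\<dots> \<le> 1/2 * q\<^sup>2 + (L1 l \<mu> * ?n + 8 * S / 9 * q * ?n)"
    using S_pos q0
    by (intro order_trans[OF norm_triangle_ineq4] add_mono residual order_trans[OF norm_triangle_ineq]
        schur_hess_bound) simp
  finally have n_ge: "1/2 * q\<^sup>2 \<le> (L1 l \<mu> + 8 * S / 9 * q) * ?n" by (simp add: algebra_simps)
  have "?e * L1 l \<mu> \<le> S * q ^ 3 / 162"
    using accuracy_mono(1)[of q] q L1_pos by (simp add: field_simps)
  moreover have "?e * (8 * S / 9 * q) \<le> 107 / 10000 * q\<^sup>2 * (8 * S / 9 * q)"
    using gradient_accuracy_quadratic[of q] q q0 S_pos by (intro mult_right_mono) auto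
  moreover have "0 \<le> S * q ^ 3" using S_pos q0 by simp
  ultimately have "?e * (L1 l \<mu> + 8 * S / 9 * q) \<le> 5/108 * S * q * (1/2 * q\<^sup>2)"
    by (simp add: eval_nat_numeral algebra_simps)
  also have "\<dots> \<le> 5/108 * S * q * ((L1 l \<mu> + 8 * S / 9 * q) * ?n)"
    using n_ge S_pos q0 by (intro mult_left_mono) auto
  finally have "?e * (L1 l \<mu> + 8 * S / 9 * q) \<le> (5/108 * S * q * ?n) * (L1 l \<mu> + 8 * S / 9 * q)"
    by (simp add: mult_ac)
  then have e: "?e \<le> 5/108 * S * q * ?n"
    using L1_pos S_pos q0 by (subst (asm) mult_le_cancel_right_pos) (auto intro: add_pos_pos)
  have "LH l \<mu> \<rho> * A * ?n\<^sup>2 \<le> S * q / 54 * ?n\<^sup>2"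
    using accuracy_mono(3)[of q] q by (intro mult_right_mono) auto
  moreover have "S\<^sup>2 / 6 * ?n ^ 3 \<le> S * q / 18 * ?n\<^sup>2"
  proof -
    have "S\<^sup>2 / 6 * ?n ^ 3 = S\<^sup>2 / 6 * ?n\<^sup>2 * ?n" by (simp add: eval_nat_numeral)
    also have "\<dots> \<le> S\<^sup>2 / 6 * ?n\<^sup>2 * (1 / (3 * S) * q)"
      by (intro mult_left_mono norm_s) auto
    also have "\<dots> = S * q / 18 * ?n\<^sup>2" using S_pos by (simp add: power2_eq_square)
    finally show ?thesis .
  qed
  moreover have "?e * ?n \<le> 5/108 * S * q * ?n * ?n" using e by (rule mult_right_mono) auto
  ultimately show ?thesis
    using inexact_model[OF acc, of s] model by (simp add: power2_eq_square)
qed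

text \<open>The new gradient splits into the gradient errors at both ends, the expansion remainder,
  the residual, the regularisation and the Hessian error; in units of \<open>q ^ 2\<close> they
  total about 0.454.\<close>

lemma interior_step_halves_gradient:
  assumes acc: "norm (y - ys x) \<le> A" and acc': "norm (y' - ys (x + s)) \<le> A"
    and q: "E < q"
    and norm_s: "norm s \<le> 1 / (3 * S) * q"
    and residual: "norm (schur_hess f x y *v s + (8 * S / 9 * q) *\<^sub>R s + grad_x f x y) \<le> 1/4 * (8 * S / 9) * q * norm s"
  shows "norm (grad_x f (x + s) y') \<le> q\<^sup>2 / 2"
proof -
  let ?n = "norm s" and ?e = "l * A"
  let ?R = "schur_hess f x y *v s + (8 * S / 9 * q) *\<^sub>R s + grad_x f x y"
  have q0: "0 < q" using q E_pos by simp
  have "grad_x f (x + s) y' = (grad_x f (x + s) y' - grad_P (x + s))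
      + ((grad_P (x + s) - grad_P x - hess_P x *v s)
      + ((?R - (8 * S / 9 * q) *\<^sub>R s)
      - ((grad_x f x y - grad_P x) + (schur_hess f x y *v s - hess_P x *v s))))"
    by simp
  also have "norm \<dots> \<le> ?e + (S\<^sup>2 / 2 * ?n\<^sup>2 + ((1/4 * (8 * S / 9) * q * ?n + 8 * S / 9 * q * ?n)
      + (?e + LH l \<mu> \<rho> * A * ?n)))"
    using S_pos q0 unfolding S_square
    by (intro norm_triangle_mono order_trans[OF norm_triangle_ineq4] add_mono residual
        gradient_error[OF acc] gradient_error[OF acc'] hessian_error[OF acc] grad_P_remainder) simp_all
  also have "\<dots> = 2 * ?e + S\<^sup>2 / 2 * ?n\<^sup>2 + 10 * S / 9 * q * ?n + LH l \<mu> \<rho> * A * ?n"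
    by simp
  also have "\<dots> \<le> 2 * (107 / 10000 * q\<^sup>2) + S\<^sup>2 / 2 * (1 / (3 * S) * q)\<^sup>2
      + 10 * S / 9 * q * (1 / (3 * S) * q) + S * q / 54 * (1 / (3 * S) * q)"
  proof (intro add_mono)
    show "2 * ?e \<le> 2 * (107 / 10000 * q\<^sup>2)"
      using gradient_accuracy_quadratic[of q] q by simp
    show "S\<^sup>2 / 2 * ?n\<^sup>2 \<le> S\<^sup>2 / 2 * (1 / (3 * S) * q)\<^sup>2"
      by (intro mult_left_mono power_mono norm_s) auto
    show "10 * S / 9 * q * ?n \<le> 10 * S / 9 * q * (1 / (3 * S) * q)"
      using S_pos q0 by (intro mult_left_mono norm_s) auto
    show "LH l \<mu> \<rho> * A * ?n \<le> S * q / 54 * (1 / (3 * S) * q)"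
      using accuracy_mono(3)[of q] q q0 S_pos norm_s by (intro mult_mono) auto
  qed
  also have "\<dots> = (214 / 10000 + 1/18 + 10/27 + 1/162) * q\<^sup>2"
    using S_pos by (simp add: power2_eq_square field_simps)
  also have "\<dots> \<le> q\<^sup>2 / 2" by simp
  finally show ?thesis .
qed

end

text \<open>
  If \<open>q\<^sup>2\<close> exceeded the bound, then with \<open>b = d / q\<close> and \<open>c = L / (S q)\<close> the two bounds on \<open>e\<close> would
  give \<open>5/2 - b\<^sup>3 \<le> min (1/c) (3c) \<le> sqrt 3\<close>, so \<open>b\<close> is close to 1 and \<open>b\<^sup>2 + c b / 3 \<ge> 1\<close>. The margin
  in this last step is about one percent.
\<close>

lemma boundary_radius_bound:
  fixes S L e q d :: real
  assumes S: "0 < S" and L: "0 < L" and q: "0 < q" and d: "0 \<le> d"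
    and e1: "e \<le> S * q ^ 3 / (162 * L)" and e2: "e \<le> L * q / (54 * S)"
    and decrease: "q * (5/2 * q\<^sup>2 - 162 * e) \<le> d ^ 3"
  shows "q\<^sup>2 \<le> L / (3 * S) * d + d\<^sup>2"
proof (rule ccontr)
  assume "\<not> ?thesis"
  then have less: "L / (3 * S) * d + d\<^sup>2 < q\<^sup>2" by simp
  define b c where "b = d / q" and "c = L / (S * q)"
  have c: "0 < c" using S L q by (simp add: c_def)
  have b0: "0 \<le> b" using q d by (simp add: b_def)
  have dL: "d = b * q" "L = c * S * q" using S q by (simp_all add: b_def c_def)
  have "(c / 3 * b + b\<^sup>2) * q\<^sup>2 < 1 * q\<^sup>2"
    using less S q unfolding dL by (simp add: power2_eq_square algebra_simps)
  then have lt1: "c / 3 * b + b\<^sup>2 < 1" using q by (subst (asm) mult_less_cancel_right_pos) auto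
  then have "b\<^sup>2 < 1" using b0 c by (smt (verit) divide_nonneg_nonneg mult_nonneg_nonneg)
  then have b1: "b < 1" by (simp add: power2_less_1_iff)
  have "162 * e \<le> q\<^sup>2 / c" "162 * e \<le> 3 * c * q\<^sup>2"
    using e1 e2 S q c unfolding dL by (simp_all add: field_simps eval_nat_numeral)
  then have "q * (5/2 * q\<^sup>2 - q\<^sup>2 / c) \<le> d ^ 3" "q * (5/2 * q\<^sup>2 - 3 * c * q\<^sup>2) \<le> d ^ 3"
    using decrease mult_left_mono[of "162 * e" _ q] q by (smt (verit) right_diff_distrib)+
  then have "(5/2 - 1 / c) * q ^ 3 \<le> b ^ 3 * q ^ 3" "(5/2 - 3 * c) * q ^ 3 \<le> b ^ 3 * q ^ 3"
    unfolding dL by (simp_all add: field_simps eval_nat_numeral)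
  then have bc: "5/2 - b ^ 3 \<le> 1 / c" "5/2 - b ^ 3 \<le> 3 * c"
    using q by (simp_all add: mult_le_cancel_right_pos)
  have "b ^ 3 \<le> 1" using b0 b1 by (simp add: power_le_one)
  then have pos: "0 \<le> 5/2 - b ^ 3" by simp
  have "(5/2 - b ^ 3) * (5/2 - b ^ 3) \<le> 1 / c * (3 * c)"
    using bc pos c by (intro mult_mono) auto
  also have "\<dots> = 3" using c by simp
  \<comment> \<open>\<open>1733/1000\<close> is a rational just above the square root of 3.\<close>
  finally have "(5/2 - b ^ 3)\<^sup>2 \<le> (1733/1000)\<^sup>2" by (simp add: power2_eq_square)
  then have b3: "767/1000 \<le> b ^ 3"
    using power2_le_imp_le[of "5/2 - b ^ 3" "1733/1000"] by simp
  \<comment> \<open>\<open>915/1000\<close> is just below the cube root of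
    \<open>767/1000\<close>.\<close>
  have b: "915/1000 \<le> b"
  proof (rule ccontr)
    assume "\<not> ?thesis"
    then have "b ^ 3 \<le> (915/1000) ^ 3" using b0 by (intro power_mono) auto
    then show False using b3 by (simp add: eval_nat_numeral)
  qed
  have "(5/2 - b ^ 3) / 3 / 3 * b \<le> c / 3 * b"
    using bc b0 by (intro mult_right_mono divide_right_mono) auto
  with lt1 have "(5/2 - b ^ 3) / 3 / 3 * b + b\<^sup>2 < 1" by linarith
  moreover have "(837/1000 :: real) \<le> b\<^sup>2"
    using power_mono[OF b, of 2] by (simp add: power2_eq_square)
  \<comment> \<open>With \<open>X = b ^ 2\<close>, the product is the increase of
    \<open>X - X ^ 2 / 9\<close> from \<open>837/1000\<close> to \<open>X\<close>, so the quartic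
    may be evaluated at the lower bound.\<close>
  then have "0 \<le> (b\<^sup>2 - 837/1000) * (1 - (b\<^sup>2 + 837/1000) / 9)"
    using \<open>b\<^sup>2 < 1\<close> by (intro mult_nonneg_nonneg) auto
  ultimately show False using b by (simp add: eval_nat_numeral algebra_simps) argo
qed

section \<open>Numerical bounds\<close>

lemma powr_three_halves: "0 < (a::real) \<Longrightarrow> a powr (3/2) = sqrt a ^ 3"
  by (simp add: powr_half_sqrt[symmetric] powr_power)

text \<open>
  Here \<open>b = sqrt (C_hat / \<epsilon>)\<close>, \<open>c = L1 / (sqrt L2 sqrt \<epsilon>)\<close>, \<open>e = \<ell> A / \<epsilon>\<close> and \<open>\<Gamma> = G_hat / \<epsilon>\<close>. The divisors
  \<open>3/2\<close> and \<open>76/100\<close> are lower bounds for \<open>5/2 - 162 e\<close>, the normalised decrease of a boundary step;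
  the weaker one, below 1, is unavoidable for \<open>c\<close> near \<open>1 / sqrt 3\<close>.
\<close>

lemma step_count_bound:
  fixes b c e :: real
  assumes b: "1 \<le> b" and c: "0 < c" and e0: "0 \<le> e" and e1: "e \<le> 1 / (162 * c)" and e2: "e \<le> c / 54"
    and Gamma: "c * b / 3 + b\<^sup>2 \<le> \<Gamma>"
  defines "\<Lambda> \<equiv> max 0 (log 2 (2 * (sqrt (c * b ^ 3 / 243) + e)))"
  shows "1 \<le> c \<Longrightarrow> b ^ 3 / (3/2) * (1 + \<Lambda>) + \<Lambda> \<le> b ^ 3 * (1 + log 2 \<Gamma>) + 1"
    and "c \<le> 1 \<Longrightarrow> b ^ 3 / (76/100) * (1 + \<Lambda>) + \<Lambda> \<le> b ^ 3 * (1 + log 2 \<Gamma>) + 1"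
proof -
  define v where "v = b ^ 3"
  define \<gamma> where "\<gamma> = 2 * (sqrt (c * v / 243) + e)"
  have v1: "1 \<le> v" and bv: "b \<le> v" "b\<^sup>2 \<le> v"
    using b power_increasing[of 1 3 b] power_increasing[of 2 3 b] by (simp_all add: v_def)
  have b2: "1 \<le> b\<^sup>2" using b by simp
  have cb: "0 \<le> c * b / 3" using b c by simp
  have G1: "1 \<le> \<Gamma>" and Gb: "b\<^sup>2 \<le> \<Gamma>" and Gc: "c * b / 3 \<le> \<Gamma>" using Gamma cb b2 by linarith+
  have lam0: "0 \<le> log 2 \<Gamma>" using G1 by simp
  have L: "\<Lambda> = max 0 (log 2 \<gamma>)" by (simp add: \<Lambda>_def \<gamma>_def v_def)
  have "0 < \<gamma>" unfolding \<gamma>_def using c v1 e0 by (simp add: add_pos_nonneg)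
  then have Lam0: "\<gamma> \<le> 1 \<Longrightarrow> \<Lambda> = 0" by (simp add: L max_def)
  have sqrt243: "31/2 \<le> sqrt (243::real)" by (rule real_le_rsqrt) (simp add: power2_eq_square)
  have root: "sqrt (c * v / 243) \<le> 2/31 * sqrt (c * v)"
  proof -
    have "sqrt (c * v) / sqrt 243 \<le> sqrt (c * v) / (31/2)"
      using sqrt243 c v1 by (intro divide_left_mono) auto
    then show ?thesis by (simp add: real_sqrt_divide)
  qed
  {
    assume c1: "1 \<le> c"
    show "b ^ 3 / (3/2) * (1 + \<Lambda>) + \<Lambda> \<le> b ^ 3 * (1 + log 2 \<Gamma>) + 1"
    proof (cases "\<gamma> \<le> 1")
      case True
      then have "\<Lambda> = 0" by (rule Lam0)
      then show ?thesis using v1 lam0 unfolding v_def[symmetric] by (simp add: distrib_left)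
    next
      case False
      define h where "h = sqrt (c * v)"
      have "1 \<le> c * v" using c1 v1 mult_mono[of 1 c 1 v] by simp
      then have h1: "1 \<le> h" and h2: "h\<^sup>2 = c * v" by (simp_all add: h_def)
      have "1 / (162 * c) \<le> 1 / 162" using c1 by (simp add: field_simps)
      \<comment> \<open>As \<open>h \<ge> 1\<close>, it suffices that \<open>4/31 + 2/162\<close> is
        just below \<open>1/7\<close>.\<close>
      then have "\<gamma> \<le> h / 7" using root e1 h1 unfolding \<gamma>_def h_def[symmetric] by simp
      then have Lh: "\<Lambda> \<le> log 2 (h / 7)" and h7: "1 < h / 7" using False L by (auto simp: max_def)
      have Lam: "0 \<le> \<Lambda>" by (simp add: L)
      \<comment> \<open>For \<open>v \<ge> 3\<close> the factor is at most \<open>v\<close>, and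
        \<open>h / 7 \<le> \<Gamma>\<close> suffices. For smaller \<open>v\<close> it is at most
        \<open>2 * v\<close>, and even the square of \<open>h / 7\<close> is below
        \<open>\<Gamma>\<close>.\<close>
      have "(2/3 * v + 1) * \<Lambda> \<le> v * log 2 \<Gamma>"
      proof (cases "v < 3")
        case True
        have "log 2 (h / 7) + log 2 (h / 7) = log 2 ((h / 7) * (h / 7))"
          using h1 by (subst log_mult) auto
        also have "(h / 7) * (h / 7) = c * v / 49" using h2 by (simp add: power2_eq_square)
        also have "log 2 (c * v / 49) \<le> log 2 \<Gamma>"
        proof -
          have "c * v / 49 \<le> c * b / 3"
            using mult_left_mono[of v "3 * b" c] True b c by simp
          then have "c * v / 49 \<le> \<Gamma>" using Gc by linarith
          then show ?thesis using c v1 G1 by (subst log_le_cancel_iff) auto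
        qed
        finally have "2 * \<Lambda> \<le> log 2 \<Gamma>" using Lh by simp
        then have "v * (2 * \<Lambda>) \<le> v * log 2 \<Gamma>" using v1 by (intro mult_left_mono) auto
        moreover have "(2/3 * v + 1) * \<Lambda> \<le> (v * 2) * \<Lambda>" using v1 Lam by (intro mult_right_mono) auto
        ultimately show ?thesis by simp
      next
        case False
        have "h / 7 \<le> \<Gamma>"
        proof (rule power2_le_imp_le)
          have "(h / 7)\<^sup>2 = (c * b / 3) * b\<^sup>2 * (3/49)"
            using h2 by (simp add: power_divide v_def eval_nat_numeral)
          also have "\<dots> \<le> (c * b / 3) * b\<^sup>2" using cb by (intro mult_right_le_one_le) auto
          also have "\<dots> \<le> \<Gamma> * \<Gamma>" using Gb Gc G1 cb by (intro mult_mono) auto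
          finally show "(h / 7)\<^sup>2 \<le> \<Gamma>\<^sup>2" by (simp add: power2_eq_square)
        qed (use G1 in simp)
        then have "\<Lambda> \<le> log 2 \<Gamma>" using Lh h7 by (smt (verit) log_le_cancel_iff)
        then have "v * \<Lambda> \<le> v * log 2 \<Gamma>" using v1 by (intro mult_left_mono) auto
        moreover have "(2/3 * v + 1) * \<Lambda> \<le> v * \<Lambda>" using False Lam by (intro mult_right_mono) auto
        ultimately show ?thesis by simp
      qed
      moreover have "v / (3/2) * (1 + \<Lambda>) + \<Lambda> = 2/3 * v + (2/3 * v + 1) * \<Lambda>"
        by (simp add: field_simps)
      ultimately show ?thesis using v1 unfolding v_def[symmetric] by (simp add: distrib_left)
    qed
  }
  {
    assume c1: "c \<le> 1"
    \<comment> \<open>In this regime \<open>b ^ 2 \<le> \<Gamma>\<close> is strong enough, so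
      \<open>log 2 \<Gamma>\<close> gives way to \<open>2 * \<beta>\<close>.\<close>
    define \<beta> where "\<beta> = log 2 b"
    have beta: "0 \<le> \<beta>" using b by (simp add: \<beta>_def)
    have "log 2 (b\<^sup>2) \<le> log 2 \<Gamma>" using Gb b2 G1 by (subst log_le_cancel_iff) auto
    then have lam: "2 * \<beta> \<le> log 2 \<Gamma>" using b by (simp add: \<beta>_def log_nat_power)
    have "e * e \<le> 1 / (162 * c) * (c / 54)" using e0 e1 e2 c by (intro mult_mono) auto
    also have "\<dots> \<le> (107/10000)\<^sup>2" using c by (simp add: power2_eq_square)
    finally have e: "e \<le> 107/10000" using power2_le_imp_le[of e "107/10000"] by (simp add: power2_eq_square)
    have "v / (76/100) * (1 + \<Lambda>) + \<Lambda> \<le> v * (1 + 2 * \<beta>) + 1"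
    proof (cases "\<gamma> \<le> 1")
      case True
      then have "\<Lambda> = 0" by (rule Lam0)
      \<comment> \<open>Either \<open>2 * \<beta>\<close> reaches 1, or \<open>v \<le> 3\<close> and
        the excess over \<open>v\<close> is covered by the additive 1.\<close>
      moreover have "v / (76/100) \<le> v * (1 + 2 * \<beta>) + 1"
      proof (cases "2 \<le> b\<^sup>2")
        case True
        have "log 2 2 \<le> log 2 (b\<^sup>2)" using True by (subst log_le_cancel_iff) auto
        then have "1 \<le> 2 * \<beta>" using b by (simp add: \<beta>_def log_nat_power)
        then have "v * (1 + 1) \<le> v * (1 + 2 * \<beta>)" using v1 by (intro mult_left_mono) auto
        moreover have "v / (76/100) \<le> v * (1 + 1)" using v1 by simp
        ultimately show ?thesis by linarith
      next
        case False
        have "b \<le> 3/2" by (rule power2_le_imp_le) (use False in \<open>simp_all add: power2_eq_square\<close>)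
        then have "v \<le> 2 * (3/2)" unfolding v_def using False b
          by (simp only: power3_eq_cube power2_eq_square[symmetric] mult.assoc[symmetric]) (intro mult_mono, auto)
        moreover have "0 \<le> v * (2 * \<beta>)" using v1 beta by simp
        moreover have "v * (1 + 2 * \<beta>) = v + v * (2 * \<beta>)" by (simp add: distrib_left)
        moreover have "v / (76/100) \<le> v + 1" using \<open>v \<le> 2 * (3/2)\<close> by simp
        ultimately show ?thesis by linarith
      qed
      ultimately show ?thesis by simp
    next
      case False
      have "c * v \<le> v" using c1 v1 mult_right_mono[of c 1 v] by simp
      then have "sqrt (c * v) \<le> sqrt v" by simp
      then have g: "\<gamma> \<le> 2 * (2/31 * sqrt v + 107/10000)"
        using root e unfolding \<gamma>_def by argo
      \<comment> \<open>\<open>\<gamma> > 1\<close> forces \<open>v\<close> to be large, so the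
        constant part of \<open>\<gamma>\<close> can be absorbed in
        \<open>sqrt v / 7\<close>.\<close>
      then have "7 \<le> sqrt v" using False by simp
      then have "\<gamma> \<le> sqrt v / 7" using g by simp
      then have "log 2 \<gamma> \<le> log 2 (sqrt v / 7)"
        using \<open>0 < \<gamma>\<close> v1 by (subst log_le_cancel_iff) auto
      then have "\<Lambda> \<le> log 2 (sqrt v / 7)" using False L by (auto simp: max_def)
      moreover have "log 2 (sqrt v / 7) + log 2 (sqrt v / 7) = log 2 ((sqrt v / 7) * (sqrt v / 7))"
        using v1 by (subst log_mult) auto
      moreover have "(sqrt v / 7) * (sqrt v / 7) = b ^ 3 / 49" using v1 by (simp add: v_def)
      moreover have "log 2 (b ^ 3 / 49) = 3 * \<beta> - log 2 49"
        using b by (subst log_divide_pos) (auto simp: log_nat_power \<beta>_def)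
      moreover have "log 2 (2 ^ 4) \<le> log 2 (49::real)" by (subst log_le_cancel_iff) auto
      then have "4 \<le> log 2 (49::real)" by (subst (asm) log_nat_power) auto
      ultimately have Lam: "\<Lambda> \<le> 3/2 * \<beta> - 2" by simp
      have "\<beta> = ln b / ln 2" by (simp add: \<beta>_def log_def)
      also have "\<dots> \<le> (b - 1) / (2/3)"
        using b ln2_ge_two_thirds ln_le_minus_one[of b] by (intro frac_le) auto
      finally have "3/2 * \<beta> \<le> 9/4 * v" using bv by simp
      moreover have "v / (76/100) * (1 + \<Lambda>) \<le> v / (76/100) * (1 + (3/2 * \<beta> - 2))"
        using Lam v1 by (intro mult_left_mono) auto
      \<comment> \<open>A divisor above 3/4 is what brings \<open>75/38\<close> below 2. The
        remaining single \<open>\<Lambda>\<close> costs less than \<open>9/4 * v\<close>, and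
        \<open>9/4 - 25/19\<close> is below 1.\<close>
      moreover have "v / (76/100) * (1 + (3/2 * \<beta> - 2)) = 75/38 * (v * \<beta>) - 25/19 * v"
        "v * (1 + 2 * \<beta>) = v + 2 * (v * \<beta>)"
        by (simp_all add: field_simps)
      moreover have "0 \<le> v * \<beta>" using v1 beta by simp
      ultimately show ?thesis using Lam v1 by argo
    qed
    also have "\<dots> \<le> v * (1 + log 2 \<Gamma>) + 1" using lam v1 by simp
    finally show "b ^ 3 / (76/100) * (1 + \<Lambda>) + \<Lambda> \<le> b ^ 3 * (1 + log 2 \<Gamma>) + 1"
      unfolding v_def .
  }
qed

section \<open>Asymptotic form of the iteration bound\<close>

lemma T_bound_eq:
  "T_bound l \<mu> \<rho> \<Delta> \<epsilon> = 486 * sqrt (L2 l \<mu> \<rho>) * \<Delta> / ln 2 * \<epsilon> powr (-3/2)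
    * (ln (inverse \<epsilon>) + ln (G_hat l \<mu> \<rho> \<Delta>) + ln 2) + 1"
  by (simp add: T_bound_def C2_hat_def C1_hat_def algebra_simps add_divide_distrib)

text \<open>The root of \<open>L2\<close> is at most three times
  \<open>sqrt \<rho> * \<kappa> powr (3/2)\<close>, so the prefactor has the target rate.
  \<open>G_hat\<close> is at most a constant times \<open>exp (3 * L)\<close>, so the logarithms are
  linear in \<open>L\<close> and the exponent 1 suffices.\<close>

lemma T_bound_soft_O: T_bound_soft_O
  unfolding T_bound_soft_O_def soft_O_def
proof (intro allI impI)
  fix D :: real assume D: "0 \<le> D"
  define B where "B = 2 + 1458 * D"
  define K where "K = 1458 * D / ln 2"
  define M where "M = 5 + ln (2 * B + 3)"
  have B: "2 \<le> B" using D by (simp add: B_def)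
  have M: "0 \<le> M" using B by (simp add: M_def)
  have K: "0 \<le> K" using D by (simp add: K_def)
  have main: "\<bar>T_bound l \<mu> \<rho> \<Delta> \<epsilon>\<bar> \<le> (K * M + 1) * L * X"
    if par: "0 < \<mu>" "\<mu> \<le> l" "0 < \<rho>" "0 \<le> \<Delta>" "\<Delta> \<le> D" "0 < \<epsilon>"
      and X: "X = l powr (3/2) * \<rho> powr (1/2) * \<mu> powr (-3/2) * \<epsilon> powr (-3/2)" and X1: "1 \<le> X"
      and L: "L = 1 + \<bar>ln l\<bar> + \<bar>ln \<mu>\<bar> + \<bar>ln \<rho>\<bar> + \<bar>ln \<epsilon>\<bar>"
    for l \<mu> \<rho> \<Delta> \<epsilon> X L :: real
  proof -
    define \<kappa> where "\<kappa> = kappa l \<mu>"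
    define S where "S = sqrt (L2 l \<mu> \<rho>)"
    define Z where "Z = sqrt \<rho> * \<kappa> powr (3/2)"
    define C where "C = C_hat l \<mu> \<rho> \<Delta>"
    define G where "G = G_hat l \<mu> \<rho> \<Delta>"
    define c where "c = L1 l \<mu> / (3 * S)"
    have l: "0 < l" using par by simp
    have k1: "1 \<le> \<kappa>" using par by (simp add: \<kappa>_def kappa_def)
    have L1': "1 \<le> L" by (simp add: L)
    have XZ: "X = Z * \<epsilon> powr (-3/2)"
      using par l by (simp add: X Z_def \<kappa>_def kappa_def powr_divide powr_minus_divide powr_half_sqrt[symmetric])
    have "0 < S" using par k1 by (simp add: S_def L2_def \<kappa>_def)
    have "\<rho> * (1 + \<kappa>) ^ 3 \<le> \<rho> * (2 * \<kappa>) ^ 3"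
      using par k1 by (intro mult_left_mono power_mono) auto
    also have "\<dots> \<le> (3 * Z)\<^sup>2"
      using par k1 by (simp add: Z_def power_mult_distrib powr_power)
    finally have SZ: "S \<le> 3 * Z"
      unfolding S_def L2_def \<kappa>_def[symmetric] using par by (intro real_le_lsqrt) (auto simp: Z_def)
    have "Z = exp (1/2 * ln \<rho> + 3/2 * (ln l - ln \<mu>))"
      using par k1 l by (simp add: Z_def powr_half_sqrt[symmetric] powr_def exp_add \<kappa>_def kappa_def ln_div)
    also have "\<dots> \<le> exp (2 * L)" unfolding exp_le_cancel_iff L by argo
    finally have ZL: "Z \<le> exp (2 * L)" .
    have "c \<le> exp L"
    proof -
      \<comment> \<open>Dropping one factor \<open>1 + \<kappa>\<close> from \<open>L2\<close> makes
        the root exact and cancels the same factor in \<open>L1\<close>.\<close>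
      have "sqrt (\<rho> * (1 + \<kappa>)\<^sup>2) \<le> S"
        unfolding S_def L2_def \<kappa>_def[symmetric] using par k1
        by (intro real_sqrt_le_mono mult_left_mono power_increasing) auto
      then have "sqrt \<rho> * (1 + \<kappa>) \<le> S" using k1 by (simp add: real_sqrt_mult)
      then have "c \<le> L1 l \<mu> / (sqrt \<rho> * (1 + \<kappa>))"
        unfolding c_def using par l k1 \<open>0 < S\<close>
        by (intro divide_left_mono) (auto simp: L1_def \<kappa>_def[symmetric])
      also have "\<dots> = l / sqrt \<rho>" using k1 by (simp add: L1_def \<kappa>_def[symmetric] add.commute)
      also have "\<dots> = exp (ln l - 1/2 * ln \<rho>)"
        using par l by (simp add: powr_half_sqrt[symmetric] powr_def exp_diff)
      also have "\<dots> \<le> exp L" unfolding exp_le_cancel_iff L by linarith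
      finally show ?thesis .
    qed
    have c0: "0 \<le> c" using l k1 \<open>0 < S\<close> by (simp add: c_def L1_def \<kappa>_def)
    have C0: "0 \<le> C" by (simp add: C_def C_hat_def)
    have SD: "486 * S * \<Delta> \<le> 1458 * D * Z"
    proof -
      have "486 * S * \<Delta> \<le> 486 * (3 * Z) * D"
        using SZ par \<open>0 < S\<close> by (intro mult_mono) auto
      then show ?thesis by (simp add: mult_ac)
    qed
    \<comment> \<open>This is \<open>z powr (2/3) \<le> 1 + z\<close> for \<open>z \<ge> 0\<close>,
      split at \<open>z = 1\<close>.\<close>
    have "C \<le> 1 + 486 * S * \<Delta>"
    proof (cases "486 * S * \<Delta> \<le> 1")
      case True
      then have "C \<le> 1 powr (2/3)" unfolding C_def C_hat_def S_def[symmetric]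
        using par \<open>0 < S\<close> by (intro powr_mono2) auto
      moreover have "0 \<le> S * \<Delta>" using par \<open>0 < S\<close> by simp
      ultimately show ?thesis by simp
    next
      case False
      then have "C \<le> (486 * S * \<Delta>) powr 1" unfolding C_def C_hat_def S_def[symmetric]
        by (intro powr_mono) auto
      then show ?thesis using False by simp
    qed
    also have "\<dots> \<le> 1 + 1458 * D * exp (2 * L)"
      using SD ZL D mult_left_mono[of Z "exp (2 * L)" "1458 * D"] by simp
    finally have "1 + C \<le> 2 * exp (2 * L) + 1458 * D * exp (2 * L)"
      using L1' one_le_exp_iff[of "2 * L"] by linarith
    then have CB: "1 + C \<le> B * exp (2 * L)" by (simp add: B_def distrib_right)
    have "sqrt C \<le> 1 + C" using C0 by (intro real_le_lsqrt) (auto simp: power2_eq_square algebra_simps)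
    have exps: "1 \<le> exp (3 * L)" "exp L \<le> exp (3 * L)" "exp (2 * L) \<le> exp (3 * L)" using L1' by simp_all
    have cC: "c * sqrt C \<le> B * exp (3 * L)"
    proof -
      have "c * sqrt C \<le> exp L * (B * exp (2 * L))"
        using \<open>c \<le> exp L\<close> \<open>sqrt C \<le> 1 + C\<close> CB c0 C0 by (intro mult_mono) auto
      also have "\<dots> = B * exp (3 * L)" by (simp add: exp_add[symmetric])
      finally show ?thesis .
    qed
    have CB3: "1 + C \<le> B * exp (3 * L)"
      by (rule order_trans[OF CB mult_left_mono[OF exps(3)]]) (use B in simp)
    have "G \<le> (2 * B + 3) * exp (3 * L)"
    proof -
      have "0 \<le> B * exp (3 * L)" using B by simp
      moreover have "(2 * B + 3) * exp (3 * L) = B * exp (3 * L) + B * exp (3 * L) + 3 * exp (3 * L)"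
        by (simp add: algebra_simps)
      ultimately have "2 + c * sqrt C + C \<le> (2 * B + 3) * exp (3 * L)" "2 + c \<le> (2 * B + 3) * exp (3 * L)"
        using cC CB3 exps \<open>c \<le> exp L\<close> by linarith+
      then show ?thesis
        unfolding G_def G_hat_def S_def[symmetric] C_def[symmetric] c_def[symmetric] by simp
    qed
    moreover have G2: "2 \<le> G" using c0 by (simp add: G_def G_hat_def c_def[symmetric] S_def[symmetric] max_def)
    ultimately have "ln G \<le> ln ((2 * B + 3) * exp (3 * L))" by simp
    also have "\<dots> = ln (2 * B + 3) + 3 * L" using B by (simp add: ln_mult)
    finally have lnG: "ln G \<le> ln (2 * B + 3) + 3 * L" .
    define Y where "Y = ln (inverse \<epsilon>) + ln G + ln 2"
    have "\<bar>Y\<bar> \<le> \<bar>ln \<epsilon>\<bar> + ln G + 1"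
    proof -
      have "0 \<le> ln G" "0 < ln (2::real)" "ln (inverse \<epsilon>) = - ln \<epsilon>"
        using G2 par by (simp_all add: ln_inverse)
      then show ?thesis using ln_2_less_1 unfolding Y_def by argo
    qed
    also have "\<dots> \<le> (4 * L + 1) + ln (2 * B + 3)" using lnG L by linarith
    also have "\<dots> \<le> M * L"
    proof -
      have "ln (2 * B + 3) * 1 \<le> ln (2 * B + 3) * L" using L1' B by (intro mult_left_mono) auto
      then show ?thesis using L1' by (simp add: M_def distrib_right)
    qed
    finally have Y: "\<bar>Y\<bar> \<le> M * L" .
    have "T_bound l \<mu> \<rho> \<Delta> \<epsilon> = 486 * S * \<Delta> / ln 2 * \<epsilon> powr (-3/2) * Y + 1"
      by (simp add: T_bound_eq S_def G_def Y_def)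
    also have "\<bar>\<dots>\<bar> \<le> 486 * S * \<Delta> / ln 2 * \<epsilon> powr (-3/2) * \<bar>Y\<bar> + 1"
      using par \<open>0 < S\<close> by (intro order_trans[OF abs_triangle_ineq]) (simp add: abs_mult)
    also have "\<dots> \<le> 1458 * D * Z / ln 2 * \<epsilon> powr (-3/2) * (M * L) + 1"
    proof -
      have "486 * S * \<Delta> / ln 2 * \<epsilon> powr (-3/2) \<le> 1458 * D * Z / ln 2 * \<epsilon> powr (-3/2)"
        by (intro mult_right_mono divide_right_mono SD) auto
      moreover have "0 \<le> 1458 * D * Z / ln 2 * \<epsilon> powr (-3/2)"
        using D par by (simp add: Z_def)
      ultimately show ?thesis by (intro add_right_mono mult_mono[OF _ Y]) auto
    qed
    also have "\<dots> = K * M * L * X + 1" by (simp add: K_def XZ mult_ac)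
    \<comment> \<open>Here \<open>1 \<le> X\<close> absorbs the additive constant.\<close>
    also have "\<dots> \<le> K * M * L * X + 1 * (L * X)"
      using L1' X1 mult_mono[of 1 L 1 X] by simp
    finally show ?thesis by (simp add: algebra_simps)
  qed
  show "\<exists>C>0. \<exists>k::nat. \<forall>p\<in>{(l, \<mu>, \<rho>, \<Delta>, \<epsilon>). 0 < \<mu> \<and> \<mu> \<le> l \<and> 0 < \<rho> \<and> 0 \<le> \<Delta> \<and> \<Delta> \<le> D \<and> 0 < \<epsilon>}.
      1 \<le> (case p of (l, \<mu>, \<rho>, \<Delta>, \<epsilon>) \<Rightarrow> l powr (3/2) * \<rho> powr (1/2) * \<mu> powr (-3/2) * \<epsilon> powr (-3/2)) \<longrightarrow>
      \<bar>case p of (l, \<mu>, \<rho>, \<Delta>, \<epsilon>) \<Rightarrow> T_bound l \<mu> \<rho> \<Delta> \<epsilon>\<bar>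
      \<le> C * (case p of (l, \<mu>, \<rho>, \<Delta>, \<epsilon>) \<Rightarrow> 1 + \<bar>ln l\<bar> + \<bar>ln \<mu>\<bar> + \<bar>ln \<rho>\<bar> + \<bar>ln \<epsilon>\<bar>) ^ k
          * (case p of (l, \<mu>, \<rho>, \<Delta>, \<epsilon>) \<Rightarrow> l powr (3/2) * \<rho> powr (1/2) * \<mu> powr (-3/2) * \<epsilon> powr (-3/2))"
  proof (rule exI[of _ "K * M + 1"], intro conjI exI[of _ 1] ballI impI)
    show "0 < K * M + 1" using K M by (simp add: add_nonneg_pos)
  qed (clarsimp simp only: prod.case mem_Collect_eq power_one_right split: prod.splits; rule main; simp)
qed

section \<open>Complexity of the algorithm\<close>

lemma y_prev_simps [simp]: "y_prev y_init y 0 = y_init" "y_prev y_init y (Suc t) = y t"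
  by (simp_all add: y_prev_def)

lemma igrtr_reached_0 [simp]: "igrtr_reached f \<sigma> \<epsilon> x y 0"
  by (simp add: igrtr_reached_def)

lemma igrtr_reached_Suc:
  "igrtr_reached f \<sigma> \<epsilon> x y (Suc t) \<longleftrightarrow>
    igrtr_reached f \<sigma> \<epsilon> x y t \<and> \<not> igrtr_stop \<sigma> \<epsilon> (grad_x f (x t) (y t)) (schur_hess f (x t) (y t))"
  by (auto simp: igrtr_reached_def less_Suc_eq)

locale igrtr = accurate f l \<mu> \<rho> Pstar S A "sqrt \<epsilon>"
  for f :: "(real^'n) \<times> (real^'m) \<Rightarrow> real" and l \<mu> \<rho> Pstar S A \<epsilon> :: real +
  fixes N :: "nat \<Rightarrow> nat" and y_init :: "real^'m"
    and x s :: "nat \<Rightarrow> real^'n" and y :: "nat \<Rightarrow> real^'m" and \<sigma> r :: real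
  assumes sigma: "\<sigma> = 8 * S / 9" and radius: "r = 1 / (3 * S)"
    and run: "igrtr_run f (1 / l) ((sqrt (kappa l \<mu>) - 1) / (sqrt (kappa l \<mu>) + 1)) \<sigma> r N \<epsilon> y_init x y s"
    and N_ge: "\<And>t. igrtr_reached f \<sigma> \<epsilon> x y t \<Longrightarrow>
      N_required (kappa l \<mu>) A (norm (y_init - y_star f (x 0))) s t \<le> real (N t)"
begin

abbreviation "reached \<equiv> igrtr_reached f \<sigma> \<epsilon> x y"
abbreviation "g t \<equiv> grad_x f (x t) (y t)"
abbreviation "H t \<equiv> schur_hess f (x t) (y t)"
abbreviation "stopped t \<equiv> igrtr_stop \<sigma> \<epsilon> (g t) (H t)"
abbreviation "\<Delta> \<equiv> P (x 0) - Pstar"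

section \<open>Accuracy, step types and monotonicity along a run\<close>

lemma eps_pos: "0 < \<epsilon>" using E_pos by simp

lemma iterate:
  assumes "reached t"
  shows "y t = fst (nag (\<lambda>v. f (x t, v)) (1 / l) ((sqrt \<kappa> - 1) / (sqrt \<kappa> + 1)) (y_prev y_init y t) (N t))"
    and "\<not> stopped t \<Longrightarrow> x (Suc t) = x t + s t"
    and "\<epsilon> < norm (g t) \<Longrightarrow> newton_cg_step \<sigma> r (g t) (H t) (s t)"
    and "norm (g t) \<le> \<epsilon> \<Longrightarrow> \<not> stopped t \<Longrightarrow> negative_curvature_step \<sigma> r \<epsilon> (g t) (H t) (s t)"
  using run assms unfolding igrtr_run_def Let_def igrtr_stop_def by blast+

text \<open>Warm start: the previous iterate lies within \<open>A + \<kappa> * norm (s t)\<close> of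
  the new maximiser, the very distance for which \<open>N_required\<close> is designed, so accuracy
  \<open>A\<close> is restored.\<close>

lemma y_accuracy: "reached t \<Longrightarrow> norm (y t - ys (x t)) \<le> A"
proof (induction t)
  case 0
  show ?case
    unfolding iterate(1)[OF 0] kappa_def
    by (rule strongly_concave_smooth.nag_accuracy[OF strongly_concave_smooth_f A_pos, of _ _ "norm (y_init - ys (x 0))"])
      (use N_ge[of 0] in \<open>simp_all add: N_required_def kappa_def\<close>)
next
  case (Suc t)
  then have t: "reached t" "\<not> stopped t" by (simp_all add: igrtr_reached_Suc)
  have "norm (y t - ys (x (Suc t))) \<le> norm (y t - ys (x t)) + norm (ys (x t) - ys (x (Suc t)))"
    using norm_triangle_ineq[of "y t - ys (x t)" "ys (x t) - ys (x (Suc t))"] by simp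
  also have "\<dots> \<le> A + \<kappa> * norm (s t)"
    using Suc.IH[OF t(1)] y_star_lipschitz[of "x t" "x (Suc t)"] by (simp add: iterate(2)[OF t])
  finally have dist: "norm (y t - ys (x (Suc t))) \<le> A + \<kappa> * norm (s t)" .
  show ?case
    unfolding iterate(1)[OF Suc.prems] kappa_def
    by (rule strongly_concave_smooth.nag_accuracy[OF strongly_concave_smooth_f A_pos, of _ _ "A + \<kappa> * norm (s t)"])
      (use N_ge[OF Suc.prems] dist in \<open>simp_all add: N_required_def kappa_def\<close>)
qed

text \<open>Negative curvature steps share a case with full-length Newton-CG steps: \<open>q\<close>
  is \<open>sqrt \<epsilon>\<close> in the former and the root of the gradient norm in the
  latter.\<close>

lemma step_cases:
  assumes "reached t" "\<not> stopped t"
  obtains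
    (boundary) q where "sqrt \<epsilon> \<le> q" "norm (g t) \<le> q\<^sup>2" "norm (s t) = 1 / (3 * S) * q"
      "P (x (Suc t)) \<le> P (x t) - q * (5/2 * q\<^sup>2 - 162 * (l * A)) / (486 * S)"
  | (interior) q where "sqrt \<epsilon> < q" "q\<^sup>2 = norm (g t)" "norm (s t) \<le> 1 / (3 * S) * q"
      "P (x (Suc t)) \<le> P (x t)" "norm (g (Suc t)) \<le> norm (g t) / 2"
proof (cases "norm (g t) \<le> \<epsilon>")
  case True
  then have "negative_curvature_step \<sigma> r \<epsilon> (g t) (H t) (s t)"
    using assms by (intro iterate(4))
  then have model: "g t \<bullet> s t + 1/2 * (s t \<bullet> (H t *v s t)) \<le> - (1/8) * (8 * S / 9) * sqrt \<epsilon> * (norm (s t))\<^sup>2"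
    and norm_s: "norm (s t) = 1 / (3 * S) * sqrt \<epsilon>"
    unfolding negative_curvature_step_def sigma radius by blast+
  show thesis
    using eps_pos True boundary_step_decrease[OF y_accuracy[OF assms(1)] order_refl model norm_s]
    by (intro boundary[OF order_refl _ norm_s]) (simp_all add: iterate(2)[OF assms])
next
  case False
  define q where "q = sqrt (norm (g t))"
  have q: "sqrt \<epsilon> < q" "q\<^sup>2 = norm (g t)" using False by (simp_all add: q_def)
  have "newton_cg_step \<sigma> r (g t) (H t) (s t)"
    using assms False by (intro iterate(3)) auto
  then have model: "g t \<bullet> s t + 1/2 * (s t \<bullet> (H t *v s t)) \<le> - (1/8) * (8 * S / 9) * q * (norm (s t))\<^sup>2"
    and alt: "norm (s t) = 1 / (3 * S) * q \<or>
      norm (s t) < 1 / (3 * S) * q \<and>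
      norm ((H t + (8 * S / 9 * q) *\<^sub>R mat 1) *v s t + g t) \<le> 1/2 * min (q\<^sup>2) (1/2 * (8 * S / 9) * q * norm (s t))"
    unfolding newton_cg_step_def sigma radius q_def[symmetric] unfolding q(2)[symmetric] by blast+
  from alt show thesis
  proof
    assume "norm (s t) = 1 / (3 * S) * q"
    with boundary_step_decrease[OF y_accuracy[OF assms(1)] _ model] q show thesis
      by (intro boundary[of q]) (simp_all add: iterate(2)[OF assms])
  next
    assume int: "norm (s t) < 1 / (3 * S) * q \<and>
      norm ((H t + (8 * S / 9 * q) *\<^sub>R mat 1) *v s t + g t) \<le> 1/2 * min (q\<^sup>2) (1/2 * (8 * S / 9) * q * norm (s t))"
    then have norm_s: "norm (s t) \<le> 1 / (3 * S) * q" by simp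
    have "(H t + (8 * S / 9 * q) *\<^sub>R mat 1) *v s t = H t *v s t + (8 * S / 9 * q) *\<^sub>R s t"
      by (simp only: matrix_vector_mult_add_rdistrib scaleR_matrix_vector_assoc[symmetric] matrix_vector_mul_lid)
    with int have res: "norm (H t *v s t + (8 * S / 9 * q) *\<^sub>R s t + g t) \<le> 1/2 * min (q\<^sup>2) (1/2 * (8 * S / 9) * q * norm (s t))"
      by simp
    have res1: "norm (H t *v s t + (8 * S / 9 * q) *\<^sub>R s t + g t) \<le> 1/2 * q\<^sup>2"
      by (rule order_trans[OF res]) simp
    have res2: "norm (H t *v s t + (8 * S / 9 * q) *\<^sub>R s t + g t) \<le> 1/4 * (8 * S / 9) * q * norm (s t)"
      by (rule order_trans[OF res]) (simp add: min_def)
    \<comment> \<open>Failing the test at \<open>t\<close> already makes \<open>y (Suc t)\<close>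
      accurate, even if the run stops there.\<close>
    have "reached (Suc t)" using assms by (simp add: igrtr_reached_Suc)
    then have "norm (y (Suc t) - ys (x t + s t)) \<le> A"
      using y_accuracy[of "Suc t"] by (simp add: iterate(2)[OF assms])
    from interior_step_halves_gradient[OF y_accuracy[OF assms(1)] this q(1) norm_s res2]
      interior_step_decrease[OF y_accuracy[OF assms(1)] q model norm_s res1]
    show thesis
      using q norm_s by (intro interior[of q]) (simp_all add: iterate(2)[OF assms])
  qed
qed

text \<open>\<open>162 * 107/10000\<close> is below \<open>1734/1000\<close>, well under the
  \<open>5/2\<close> from which it is subtracted.\<close>

lemma boundary_decrease_pos:
  assumes "sqrt \<epsilon> \<le> q"
  shows "162 * (l * A) \<le> 1734 / 1000 * q\<^sup>2"
    and "0 \<le> q * (5/2 * q\<^sup>2 - 162 * (l * A)) / (486 * S)"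
proof -
  show *: "162 * (l * A) \<le> 1734 / 1000 * q\<^sup>2"
    using gradient_accuracy_quadratic[OF assms] zero_le_power2[of q] by linarith
  have "0 \<le> q" using less_le_trans[OF E_pos assms] by simp
  moreover have "0 \<le> 5/2 * q\<^sup>2 - 162 * (l * A)" using * zero_le_power2[of q] by linarith
  ultimately show "0 \<le> q * (5/2 * q\<^sup>2 - 162 * (l * A)) / (486 * S)"
    using S_pos by (intro divide_nonneg_pos mult_nonneg_nonneg) auto
qed

lemma P_step: "reached t \<Longrightarrow> \<not> stopped t \<Longrightarrow> P (x (Suc t)) \<le> P (x t)"
  by (erule (1) step_cases) (use boundary_decrease_pos(2) in fastforce)+

lemma P_le_initial: "reached t \<Longrightarrow> P (x t) \<le> P (x 0)"
  by (induction t) (auto simp: igrtr_reached_Suc dest: P_step)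

lemma Delta_nonneg: "0 \<le> \<Delta>" using Pstar_le by simp

lemma norm_g_le:
  assumes "reached t"
  shows "norm (g t) \<le> sqrt (2 * L1 l \<mu> * \<Delta>) + l * A"
proof -
  have "(norm (grad_P (x t)))\<^sup>2 \<le> 2 * L1 l \<mu> * (P (x t) - Pstar)" by (rule grad_P_bound)
  also have "\<dots> \<le> 2 * L1 l \<mu> * \<Delta>"
    using P_le_initial[OF assms] L1_pos by (intro mult_left_mono) auto
  finally have "norm (grad_P (x t)) \<le> sqrt (2 * L1 l \<mu> * \<Delta>)" by (rule real_le_rsqrt)
  then show ?thesis
    using gradient_error[OF y_accuracy[OF assms]] norm_triangle_ineq2[of "g t" "grad_P (x t)"] by simp
qed

text \<open>The root of \<open>C_hat\<close> is the \<open>q\<close> for which a decrease of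
  \<open>q ^ 3 / (486 * S)\<close> would use up the whole gap.\<close>

lemma C_hat_cube: "sqrt (C_hat l \<mu> \<rho> \<Delta>) ^ 3 = 486 * S * \<Delta>"
proof (cases "\<Delta> = 0")
  case False
  then have pos: "0 < 486 * S * \<Delta>" using S_pos Delta_nonneg by simp
  have "sqrt (C_hat l \<mu> \<rho> \<Delta>) ^ 3 = ((486 * S * \<Delta>) powr (1/3)) ^ 3"
    by (simp add: C_hat_def S_def[symmetric] powr_half_sqrt[symmetric] powr_powr)
  also have "\<dots> = (486 * S * \<Delta>) powr 1"
    using pos by (subst powr_power) auto
  finally show ?thesis using pos by (simp only: powr_one)
qed (simp add: C_hat_def S_def[symmetric])

lemma C_hat_nonneg: "0 \<le> C_hat l \<mu> \<rho> \<Delta>" by (simp add: C_hat_def)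

lemma G_hat_ge:
  "2 + L1 l \<mu> / (3 * S) * sqrt (C_hat l \<mu> \<rho> \<Delta>) + C_hat l \<mu> \<rho> \<Delta> \<le> G_hat l \<mu> \<rho> \<Delta>"
  by (simp add: G_hat_def S_def[symmetric])

text \<open>AM-GM on the last two summands of the first expression in \<open>G_hat\<close> compares it with the gradient bound \<open>sqrt (2 L1 \<Delta>)\<close>.\<close>

lemma sqrt_Delta_le_G_hat: "9 * sqrt (2 * L1 l \<mu> * \<Delta>) \<le> L1 l \<mu> / (3 * S) * sqrt (C_hat l \<mu> \<rho> \<Delta>) / 2 + C_hat l \<mu> \<rho> \<Delta> / 2"
proof -
  define d where "d = sqrt (C_hat l \<mu> \<rho> \<Delta>)"
  have d: "C_hat l \<mu> \<rho> \<Delta> = d\<^sup>2" "0 \<le> d" using C_hat_nonneg by (simp_all add: d_def)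
  have Delta: "\<Delta> = d ^ 3 / (486 * S)" using C_hat_cube S_pos by (simp add: d_def)
  let ?a = "L1 l \<mu> / (3 * S) * d"
  have a: "0 \<le> ?a" using L1_pos S_pos d by simp
  have "81 * (2 * L1 l \<mu> * \<Delta>) = ?a * d\<^sup>2"
    unfolding Delta using S_pos by (simp add: eval_nat_numeral)
  also have "\<dots> \<le> (?a / 2 + d\<^sup>2 / 2)\<^sup>2"
  proof -
    have "(a / 2 + b / 2)\<^sup>2 - a * b = (a / 2 - b / 2)\<^sup>2" for a b :: real
      by (simp add: power2_eq_square field_simps)
    from this[of ?a "d\<^sup>2"] show ?thesis using zero_le_power2[of "?a / 2 - d\<^sup>2 / 2"] by linarith
  qed
  finally have "sqrt (81 * (2 * L1 l \<mu> * \<Delta>)) \<le> ?a / 2 + d\<^sup>2 / 2"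
    using a by (intro real_le_lsqrt) auto
  moreover have "sqrt 81 = 9" by (rule real_sqrt_unique) auto
  ultimately show ?thesis unfolding d_def[symmetric] unfolding d(1) by (simp only: real_sqrt_mult)
qed

text \<open>A boundary step cannot decrease \<open>P\<close> by more than \<open>\<Delta>\<close>,
  which limits \<open>q\<close> by \<open>boundary_radius_bound\<close>. For an interior step
  \<open>q ^ 2\<close> is the gradient norm, and its error \<open>l * A\<close> is a small fraction
  of \<open>q ^ 2\<close>.\<close>

lemma norm_step_le:
  assumes "reached t" "\<not> stopped t"
  shows "norm (s t) \<le> r * sqrt (G_hat l \<mu> \<rho> \<Delta>)"
proof -
  have "\<exists>q. norm (s t) \<le> 1 / (3 * S) * q \<and> q\<^sup>2 \<le> G_hat l \<mu> \<rho> \<Delta>"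
    using assms
  proof (cases rule: step_cases)
    case (boundary q)
    have q0: "0 < q" using less_le_trans[OF E_pos boundary(1)] .
    have "q * (5/2 * q\<^sup>2 - 162 * (l * A)) / (486 * S) \<le> \<Delta>"
      using boundary(4) P_le_initial[OF assms(1)] Pstar_le[of "x (Suc t)"] by simp
    then have "q * (5/2 * q\<^sup>2 - 162 * (l * A)) \<le> sqrt (C_hat l \<mu> \<rho> \<Delta>) ^ 3"
      unfolding C_hat_cube using S_pos by (simp add: field_simps)
    from boundary_radius_bound[OF S_pos L1_pos q0 _ accuracy_mono(1,2)[OF boundary(1)] this]
    have "q\<^sup>2 \<le> L1 l \<mu> / (3 * S) * sqrt (C_hat l \<mu> \<rho> \<Delta>) + C_hat l \<mu> \<rho> \<Delta>"
      using C_hat_nonneg by simp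
    then show ?thesis using G_hat_ge boundary(3) by (intro exI[of _ q]) simp
  next
    case (interior q)
    have "0 \<le> L1 l \<mu> / (3 * S) * sqrt (C_hat l \<mu> \<rho> \<Delta>)" using L1_pos S_pos C_hat_nonneg by simp
    then have "q\<^sup>2 \<le> G_hat l \<mu> \<rho> \<Delta>"
      using norm_g_le[OF assms(1)] sqrt_Delta_le_G_hat gradient_accuracy_quadratic[of q] interior(1,2)
        G_hat_ge C_hat_nonneg by simp
    then show ?thesis using interior(3) by blast
  qed
  then obtain q where q: "norm (s t) \<le> 1 / (3 * S) * q" "q\<^sup>2 \<le> G_hat l \<mu> \<rho> \<Delta>" by blast
  have "q \<le> sqrt (G_hat l \<mu> \<rho> \<Delta>)" using q(2) by (rule real_le_rsqrt)
  then have "1 / (3 * S) * q \<le> 1 / (3 * S) * sqrt (G_hat l \<mu> \<rho> \<Delta>)"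
    using S_pos by (intro mult_left_mono) auto
  with q(1) show ?thesis by (simp add: radius)
qed

text \<open>The factor 2 keeps the value at least 1 while the gradient norm is at least
  \<open>\<epsilon>\<close>, so a halving lowers it by a full unit despite the cut-off at 0.\<close>

definition log_excess :: "nat \<Rightarrow> real" where
  "log_excess t = max 0 (log 2 (2 * norm (g t) / \<epsilon>))"

text \<open>
  The potential \<open>(P(x\<^sub>t) - P\<^sup>*) (1 + \<Lambda>) / \<delta> + log_excess t\<close> drops by at least 1 in every step:
  an interior step halves the gradient, and a boundary step pays for any increase of
  \<open>log_excess\<close> by its decrease \<open>\<delta>\<close> of \<open>P\<close>.
\<close>

lemma reached_bound:
  assumes delta: "0 < \<delta>" "\<delta> \<le> sqrt \<epsilon> * (5/2 * \<epsilon> - 162 * (l * A)) / (486 * S)"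
    and bound: "\<And>t. reached t \<Longrightarrow> log_excess t \<le> \<Lambda>" and "reached n"
  shows "real n \<le> \<Delta> * (1 + \<Lambda>) / \<delta> + \<Lambda>"
proof -
  have Lambda: "0 \<le> \<Lambda>" using bound[of 0] by (simp add: log_excess_def)
  have "real n \<le> (P (x 0) - P (x n)) * ((1 + \<Lambda>) / \<delta>) + \<Lambda> - log_excess n"
    using \<open>reached n\<close>
  proof (induction n)
    case 0
    then show ?case using bound[of 0] by simp
  next
    case (Suc t)
    then have t: "reached t" "\<not> stopped t" by (simp_all add: igrtr_reached_Suc)
    from t show ?case
    proof (cases rule: step_cases)
      case (boundary q)
      have "sqrt \<epsilon> * (5/2 * (sqrt \<epsilon>)\<^sup>2 - 162 * (l * A)) \<le> q * (5/2 * q\<^sup>2 - 162 * (l * A))"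
      proof (intro mult_mono diff_right_mono mult_left_mono power_mono boundary(1))
        show "0 \<le> q" using less_le_trans[OF E_pos boundary(1)] by simp
        show "0 \<le> 5/2 * (sqrt \<epsilon>)\<^sup>2 - 162 * (l * A)"
          using boundary_decrease_pos(1)[of "sqrt \<epsilon>"] zero_le_power2[of "sqrt \<epsilon>"] by linarith
      qed (use eps_pos in auto)
      then have "sqrt \<epsilon> * (5/2 * \<epsilon> - 162 * (l * A)) / (486 * S) \<le> q * (5/2 * q\<^sup>2 - 162 * (l * A)) / (486 * S)"
        using S_pos eps_pos by (intro divide_right_mono) auto
      then have "\<delta> \<le> P (x t) - P (x (Suc t))" using boundary(4) delta(2) by simp
      then have "\<delta> * ((1 + \<Lambda>) / \<delta>) \<le> (P (x t) - P (x (Suc t))) * ((1 + \<Lambda>) / \<delta>)"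
        using Lambda delta(1) by (intro mult_right_mono) auto
      then have "1 + \<Lambda> \<le> (P (x t) - P (x (Suc t))) * ((1 + \<Lambda>) / \<delta>)" using delta(1) by simp
      moreover have "0 \<le> log_excess t" "log_excess (Suc t) \<le> \<Lambda>"
        using bound[OF Suc.prems] by (simp_all add: log_excess_def)
      ultimately show ?thesis using Suc.IH[OF t(1)] by (simp add: algebra_simps)
    next
      case (interior q)
      have "(sqrt \<epsilon>)\<^sup>2 \<le> q\<^sup>2" using interior(1) E_pos by (intro power_mono) auto
      then have g: "\<epsilon> \<le> norm (g t)" using interior(2) eps_pos by simp
      have "log_excess (Suc t) \<le> log_excess t - 1"
      proof -
        have "log 2 2 \<le> log 2 (2 * norm (g t) / \<epsilon>)"
          using g eps_pos by (subst log_le_cancel_iff) (auto simp: field_simps zero_less_mult_iff)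
        then have one: "1 \<le> log 2 (2 * norm (g t) / \<epsilon>)" by simp
        moreover have "log 2 (2 * norm (g (Suc t)) / \<epsilon>) \<le> log 2 (2 * norm (g t) / \<epsilon>) - 1"
        proof (cases "g (Suc t) = 0")
          \<comment> \<open>\<open>log 2 0\<close> evaluates to 0, so the claim rests on
            \<open>one\<close>.\<close>
          case True
          then show ?thesis using one by (simp add: log_def)
        next
          case False
          have pos': "0 < norm (g t) / \<epsilon>"
            by (rule divide_pos_pos[OF less_le_trans[OF eps_pos g] eps_pos])
          then have pos: "0 < 2 * norm (g t) / \<epsilon>" by simp
          have "log 2 (2 * norm (g (Suc t)) / \<epsilon>) \<le> log 2 ((2 * norm (g t) / \<epsilon>) / 2)"
            using interior(5) False eps_pos pos' by (subst log_le_cancel_iff) (auto simp: divide_right_mono)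
          also have "\<dots> = log 2 (2 * norm (g t) / \<epsilon>) - log 2 2"
            by (rule log_divide_pos[OF pos]) simp
          finally show ?thesis by simp
        qed
        ultimately show ?thesis by (simp add: log_excess_def)
      qed
      moreover have "0 \<le> (P (x t) - P (x (Suc t))) * ((1 + \<Lambda>) / \<delta>)"
        using interior(4) Lambda delta(1) by (intro mult_nonneg_nonneg) auto
      ultimately show ?thesis using Suc.IH[OF t(1)] by (simp add: algebra_simps)
    qed
  qed
  also have "\<dots> \<le> \<Delta> * ((1 + \<Lambda>) / \<delta>) + \<Lambda>"
  proof -
    have "(P (x 0) - P (x n)) * ((1 + \<Lambda>) / \<delta>) \<le> \<Delta> * ((1 + \<Lambda>) / \<delta>)"
      using Pstar_le[of "x n"] Lambda delta(1) by (intro mult_right_mono) auto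
    then show ?thesis by (simp add: log_excess_def)
  qed
  finally show ?thesis by simp
qed

end

section \<open>Termination and the iteration bound\<close>

context igrtr
begin

lemma log_excess_le:
  assumes "reached t"
  shows "log_excess t \<le> max 0 (log 2 (2 * (sqrt (2 * L1 l \<mu> * \<Delta>) + l * A) / \<epsilon>))"
proof (cases "g t = 0")
  case False
  have "2 * norm (g t) / \<epsilon> \<le> 2 * (sqrt (2 * L1 l \<mu> * \<Delta>) + l * A) / \<epsilon>"
    using norm_g_le[OF assms] eps_pos by (intro divide_right_mono mult_left_mono) auto
  moreover have "0 < 2 * norm (g t) / \<epsilon>" using False eps_pos by simp
  ultimately have "log 2 (2 * norm (g t) / \<epsilon>) \<le> log 2 (2 * (sqrt (2 * L1 l \<mu> * \<Delta>) + l * A) / \<epsilon>)"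
    by (subst log_le_cancel_iff) auto
  then show ?thesis by (simp add: log_excess_def)
qed (simp add: log_excess_def log_def)

lemma boundary_decrease_eps: "162 * (l * A) \<le> 1734 / 1000 * \<epsilon>"
  using boundary_decrease_pos(1)[OF order_refl] eps_pos by simp

text \<open>Without a stop every \<open>n\<close> would be reached, whereas
  \<open>reached_bound\<close> is finite. This holds for every \<open>\<epsilon>\<close>, also above
  \<open>C_hat\<close>.\<close>

lemma eventually_stopped: "\<exists>t. stopped t"
proof (rule ccontr)
  assume "\<nexists>t. stopped t"
  then have reached: "reached n" for n by (simp add: igrtr_reached_def)
  define \<delta> where "\<delta> = sqrt \<epsilon> * (5/2 * \<epsilon> - 162 * (l * A)) / (486 * S)"
  define \<Lambda> where "\<Lambda> = max 0 (log 2 (2 * (sqrt (2 * L1 l \<mu> * \<Delta>) + l * A) / \<epsilon>))"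
  have "0 < 5/2 * \<epsilon> - 162 * (l * A)" using boundary_decrease_eps eps_pos by linarith
  then have delta: "0 < \<delta>" using S_pos E_pos by (simp add: \<delta>_def)
  have bound: "log_excess t \<le> \<Lambda>" if "reached t" for t
    unfolding \<Lambda>_def by (rule log_excess_le[OF that])
  have "real n \<le> \<Delta> * (1 + \<Lambda>) / \<delta> + \<Lambda>" for n
    by (rule reached_bound[OF delta _ bound reached]) (auto simp: \<delta>_def)
  then show False by (metis reals_Archimedean2 not_le)
qed

text \<open>Scaling by powers of \<open>sqrt \<epsilon>\<close> reduces the claim to
  \<open>step_count_bound\<close>; the hypothesis on \<open>\<epsilon>\<close> becomes
  \<open>1 \<le> b\<close>, so that \<open>b ^ 3\<close> times the logarithm can absorb the one
  \<open>\<Lambda>\<close> outside the product.\<close>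

lemma reached_T_bound:
  assumes eps: "\<epsilon> \<le> C_hat l \<mu> \<rho> \<Delta>" and "reached n"
  shows "real n \<le> T_bound l \<mu> \<rho> \<Delta> \<epsilon>"
proof -
  define E where "E = sqrt \<epsilon>"
  define d where "d = sqrt (C_hat l \<mu> \<rho> \<Delta>)"
  define b c e where "b = d / E" and "c = L1 l \<mu> / (S * E)" and "e = l * A / \<epsilon>"
  define \<Gamma> where "\<Gamma> = G_hat l \<mu> \<rho> \<Delta> / \<epsilon>"
  define \<Lambda> where "\<Lambda> = max 0 (log 2 (2 * (sqrt (c * b ^ 3 / 243) + e)))"
  have E: "0 < E" "\<epsilon> = E\<^sup>2" using eps_pos by (simp_all add: E_def)
  have C: "C_hat l \<mu> \<rho> \<Delta> = d\<^sup>2" "0 \<le> d" using C_hat_nonneg by (simp_all add: d_def)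
  have "E \<le> d" using eps by (simp add: E_def d_def)
  then have b1: "1 \<le> b" using E by (simp add: b_def)
  have d: "d = b * E" using E by (simp add: b_def)
  have c0: "0 < c" using L1_pos S_pos E by (simp add: c_def)
  have Lc: "L1 l \<mu> = c * (S * E)" using S_pos E by (simp add: c_def)
  have lA: "l * A = e * E\<^sup>2" using E by (simp add: e_def)
  have e0: "0 \<le> e" using l_pos A_pos eps_pos by (simp add: e_def)
  have e1: "e \<le> 1 / (162 * c)"
    using accuracy_mono(1)[OF order_refl] c0 S_pos E unfolding E_def[symmetric] lA Lc
    by (simp add: field_simps eval_nat_numeral)
  have e2: "e \<le> c / 54"
    using accuracy_mono(2)[OF order_refl] c0 S_pos E unfolding E_def[symmetric] lA Lc
    by (simp add: field_simps eval_nat_numeral)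
  have Delta: "486 * S * \<Delta> = b ^ 3 * E ^ 3"
    using C_hat_cube by (simp add: d_def[symmetric] d power_mult_distrib)
  have "c * b / 3 * \<epsilon> + b\<^sup>2 * \<epsilon> = L1 l \<mu> / (3 * S) * sqrt (C_hat l \<mu> \<rho> \<Delta>) + C_hat l \<mu> \<rho> \<Delta>"
    unfolding d_def[symmetric] unfolding C(1) d Lc E(2) using S_pos by (simp add: power2_eq_square)
  then have "(c * b / 3 + b\<^sup>2) * \<epsilon> \<le> G_hat l \<mu> \<rho> \<Delta>"
    using G_hat_ge by (simp add: distrib_right)
  then have Gamma: "c * b / 3 + b\<^sup>2 \<le> \<Gamma>" using eps_pos by (simp add: \<Gamma>_def field_simps)
  have "2 * L1 l \<mu> * \<Delta> = c * b ^ 3 / 243 * (E\<^sup>2)\<^sup>2"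
  proof -
    have "2 * L1 l \<mu> * \<Delta> = c * E * (486 * S * \<Delta>) / 243" unfolding Lc by simp
    then show ?thesis unfolding Delta by (simp add: eval_nat_numeral)
  qed
  then have "sqrt (2 * L1 l \<mu> * \<Delta>) = sqrt (c * b ^ 3 / 243) * E\<^sup>2"
    using E by (simp only: real_sqrt_mult real_sqrt_abs abs_power2)
  then have "2 * (sqrt (2 * L1 l \<mu> * \<Delta>) + l * A) / \<epsilon> = 2 * (sqrt (c * b ^ 3 / 243) + e)"
    unfolding lA E(2) using E(1) by (simp add: add_divide_distrib)
  then have excess: "log_excess t \<le> \<Lambda>" if "reached t" for t
    using log_excess_le[OF that] by (simp add: \<Lambda>_def)
  \<comment> \<open>\<open>k\<close> is any positive lower bound for the normalised boundary
    decrease; the two regimes of \<open>c\<close> choose different ones.\<close>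
  have step: "real n \<le> b ^ 3 / k * (1 + \<Lambda>) + \<Lambda>" if k: "0 < k" "k \<le> 5/2 - 162 * e" for k
  proof -
    have "0 < k * E ^ 3 / (486 * S)" using k E S_pos by simp
    moreover have "k * E ^ 3 / (486 * S) \<le> sqrt \<epsilon> * (5/2 * \<epsilon> - 162 * (l * A)) / (486 * S)"
      using mult_right_mono[OF k(2), of "E ^ 3"] S_pos E(1)
      unfolding E_def[symmetric] lA E(2) by (intro divide_right_mono) (simp_all add: algebra_simps eval_nat_numeral)
    ultimately have "real n \<le> \<Delta> * (1 + \<Lambda>) / (k * E ^ 3 / (486 * S)) + \<Lambda>"
      by (rule reached_bound[OF _ _ excess \<open>reached n\<close>])
    also have "\<Delta> * (1 + \<Lambda>) / (k * E ^ 3 / (486 * S)) = (486 * S * \<Delta>) / E ^ 3 / k * (1 + \<Lambda>)"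
      by (simp add: mult_ac)
    also have "(486 * S * \<Delta>) / E ^ 3 = b ^ 3" unfolding Delta using E by simp
    finally show ?thesis .
  qed
  have "real n \<le> b ^ 3 * (1 + log 2 \<Gamma>) + 1"
  proof (cases "1 \<le> c")
    case True
    then have "1 / (162 * c) \<le> 1 / 162" by (simp add: field_simps)
    then have "3/2 \<le> 5/2 - 162 * e" using e1 by simp
    then show ?thesis
      using step[of "3/2"] step_count_bound(1)[OF b1 c0 e0 e1 e2 Gamma True] unfolding \<Lambda>_def[symmetric] by simp
  next
    case False
    have "76/100 \<le> 5/2 - 162 * e"
    proof -
      have "162 * e * \<epsilon> \<le> 1734 / 1000 * \<epsilon>" using boundary_decrease_eps eps_pos by (simp add: e_def)
      then show ?thesis using eps_pos by simp
    qed
    then show ?thesis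
      using step[of "76/100"] step_count_bound(2)[OF b1 c0 e0 e1 e2 Gamma] False unfolding \<Lambda>_def[symmetric] by simp
  qed
  also have "\<dots> = T_bound l \<mu> \<rho> \<Delta> \<epsilon>"
  proof -
    have powr: "\<epsilon> powr (-3/2) = 1 / E ^ 3"
      using eps_pos by (simp add: powr_minus_divide powr_three_halves E_def)
    have "0 < \<Gamma> * \<epsilon>" using Gamma c0 b1 eps_pos by (smt (verit) mult_pos_pos zero_less_power divide_pos_pos)
    then have G: "0 < G_hat l \<mu> \<rho> \<Delta>" using eps_pos by (simp add: \<Gamma>_def)
    \<comment> \<open>Change of base: it explains the denominator \<open>ln 2\<close> in
      \<open>C1_hat\<close>, while the summand \<open>ln 2\<close> in \<open>C2_hat\<close> comes
      from the 1.\<close>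
    have "ln 2 * (1 + log 2 \<Gamma>) = ln (inverse \<epsilon>) + ln (G_hat l \<mu> \<rho> \<Delta>) + ln 2"
      using G eps_pos by (simp add: \<Gamma>_def log_def ln_div ln_inverse distrib_left)
    moreover have "486 * S * \<Delta> / ln 2 * (1 / E ^ 3) * (ln 2 * (1 + log 2 \<Gamma>)) = b ^ 3 * (1 + log 2 \<Gamma>)"
      unfolding Delta using E by simp
    ultimately show ?thesis unfolding T_bound_eq powr S_def by simp
  qed
  finally show ?thesis .
qed

end

text \<open>The first conjunct gives \<open>LEAST\<close> its meaning. Inner iterations are summed
  first as prescribed by \<open>N_required\<close>, then as performed: the \<open>N t\<close> are
  natural numbers bounded only from below, and \<open>\<delta>\<close> measures their overshoot, for
  instance 1 when nonnegative prescriptions are rounded up.\<close>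

theorem theorem2p2:
  fixes f :: "(real^'n) \<times> (real^'m) \<Rightarrow> real"
    and l \<mu> \<rho> Pstar \<epsilon> \<epsilon>1 \<epsilon>2 \<sigma> r \<eta> \<theta> \<kappa> A \<Delta> G :: real
    and N :: "nat \<Rightarrow> nat"
    and y_init :: "real^'m"
    and x s :: "nat \<Rightarrow> real^'n"
    and y :: "nat \<Rightarrow> real^'m"
    and stop :: "nat \<Rightarrow> bool"
    and T :: nat
  assumes mu_pos: "0 < \<mu>" and rho_pos: "0 < \<rho>"
    and f_assms: "minimax_assumptions f l \<mu> \<rho> Pstar"
    and kappa: "\<kappa> = kappa l \<mu>"
    and eps: "0 < \<epsilon>"
    and sigma: "\<sigma> = 8 * sqrt (L2 l \<mu> \<rho>) / 9"
    and radius: "r = 1 / (3 * sqrt (L2 l \<mu> \<rho>))"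
    and eps1: "0 < \<epsilon>1"
      "\<epsilon>1 \<le> min (1/162) (sqrt (L2 l \<mu> \<rho>) / (162 * L1 l \<mu>)) * \<epsilon> powr (3/2)"
    and eps2: "0 < \<epsilon>2" "\<epsilon>2 \<le> sqrt (L2 l \<mu> \<rho>) / 27 * sqrt \<epsilon>"
    and eta: "\<eta> = 1 / l"
    and theta: "\<theta> = (sqrt \<kappa> - 1) / (sqrt \<kappa> + 1)"
    and A: "A = min (\<epsilon>1 / l) (\<epsilon>2 / (2 * LH l \<mu> \<rho>))"
    and run: "igrtr_run f \<eta> \<theta> \<sigma> r N \<epsilon> y_init x y s"
    and N_ge: "\<And>t. igrtr_reached f \<sigma> \<epsilon> x y t \<Longrightarrow>
      real (N t) \<ge> N_required \<kappa> A (norm (y_init - y_star f (x 0))) s t"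
    and Delta: "\<Delta> = primal f (x 0) - Pstar"
    and G: "G = G_hat l \<mu> \<rho> \<Delta>"
    and stop: "\<And>t. stop t \<longleftrightarrow>
      norm (grad_x f (x t) (y t)) \<le> \<epsilon> \<and>
      lambda_min (schur_hess f (x t) (y t)) \<ge> - (4/9) * sqrt (L2 l \<mu> \<rho> * \<epsilon>)"
    and T: "T = (LEAST t. stop t)"
  shows "(\<exists>t. stop t) \<and>
    (\<epsilon> \<le> C_hat l \<mu> \<rho> \<Delta> \<longrightarrow>
      real T \<le> T_bound l \<mu> \<rho> \<Delta> \<epsilon>) \<and>
    T_bound_soft_O \<and>
    (\<Sum>t\<le>T. N_required \<kappa> A (norm (y_init - y_star f (x 0))) s t)
      \<le> 2 * sqrt \<kappa> * ln (sqrt (\<kappa> + 1) * norm (y_init - y_star f (x 0)) / A)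
        + 2 * sqrt \<kappa> * real T * ln (sqrt (\<kappa> + 1) * (A + \<kappa> * r * sqrt G) / A) \<and>
    (\<forall>\<delta>\<ge>0.
      (\<forall>t\<le>T. real (N t) \<le> N_required \<kappa> A (norm (y_init - y_star f (x 0))) s t + \<delta>) \<longrightarrow>
      (\<Sum>t\<le>T. real (N t))
        \<le> 2 * sqrt \<kappa> * ln (sqrt (\<kappa> + 1) * norm (y_init - y_star f (x 0)) / A)
          + 2 * sqrt \<kappa> * real T * ln (sqrt (\<kappa> + 1) * (A + \<kappa> * r * sqrt G) / A)
          + \<delta> * (real T + 1))"
proof -
  define S where "S = sqrt (L2 l \<mu> \<rho>)"
  interpret minimax f l \<mu> \<rho> Pstar
    using mu_pos rho_pos f_assms by unfold_locales
  have LH: "0 < LH l \<mu> \<rho>" and S: "0 < S"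
    using rho_pos kappa_ge_1 by (simp_all add: LH_def S_def L2_def)
  have A_pos: "0 < A" using eps1(1) eps2(1) l_pos LH by (simp add: A)
  have "l * A \<le> \<epsilon>1" "2 * LH l \<mu> \<rho> * A \<le> \<epsilon>2"
    using l_pos LH by (simp_all add: A min_def field_simps)
  moreover have "\<epsilon>1 \<le> S / (162 * L1 l \<mu>) * \<epsilon> powr (3/2)"
    using eps1(2) unfolding S_def[symmetric] by (rule order_trans) (intro mult_right_mono, auto)
  ultimately have acc: "l * A \<le> S * sqrt \<epsilon> ^ 3 / (162 * L1 l \<mu>)" "LH l \<mu> \<rho> * A \<le> S * sqrt \<epsilon> / 54"
    using eps2(2) eps by (simp_all add: powr_three_halves S_def)
  interpret igrtr f l \<mu> \<rho> Pstar S A \<epsilon> N y_init x s y \<sigma> r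
  proof unfold_locales
    show "igrtr_run f (1 / l) ((sqrt (kappa l \<mu>) - 1) / (sqrt (kappa l \<mu>) + 1)) \<sigma> r N \<epsilon> y_init x y s"
      using run by (simp add: eta theta kappa)
    show "igrtr_reached f \<sigma> \<epsilon> x y t \<Longrightarrow>
        N_required (kappa l \<mu>) A (norm (y_init - y_star f (x 0))) s t \<le> real (N t)" for t
      using N_ge by (simp add: kappa)
  qed (use A_pos acc eps sigma radius in \<open>simp_all add: S_def\<close>)
  \<comment> \<open>Half of \<open>\<sigma>\<close> is \<open>4/9 * S\<close>, so both tests have
    the same threshold.\<close>
  have stop_eq: "stop t \<longleftrightarrow> stopped t" for t
    unfolding stop igrtr_stop_def sigma by (simp add: real_sqrt_mult S_def mult.assoc)
  have ex: "\<exists>t. stop t" using eventually_stopped by (simp add: stop_eq)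
  have not_stop: "\<not> stopped t" if "t < T" for t
    using not_less_Least[of t stop] that by (simp add: T stop_eq)
  then have reached: "reached t" if "t \<le> T" for t
    using that by (simp add: igrtr_reached_def)
  let ?d0 = "norm (y_init - y_star f (x 0))"
  let ?a = "2 * sqrt \<kappa> * ln (sqrt (\<kappa> + 1) * ?d0 / A)"
  let ?b = "ln (sqrt (\<kappa> + 1) * (A + \<kappa> * r * sqrt G) / A)"
  have k1: "1 \<le> \<kappa>" using kappa_ge_1 by (simp add: kappa)
  \<comment> \<open>Strictly before \<open>T\<close> the test fails, so a step exists and
    \<open>norm_step_le\<close> applies.\<close>
  have step: "N_required \<kappa> A ?d0 s (Suc t) \<le> 2 * sqrt \<kappa> * ?b" if "t < T" for t
  proof -
    have "\<kappa> * norm (s t) \<le> \<kappa> * (r * sqrt G)"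
      using norm_step_le[OF reached not_stop] that k1 unfolding G Delta by (intro mult_left_mono) auto
    then have "sqrt (\<kappa> + 1) * (A + \<kappa> * norm (s t)) / A \<le> sqrt (\<kappa> + 1) * (A + \<kappa> * r * sqrt G) / A"
      using A_pos k1 by (intro divide_right_mono mult_left_mono) (auto simp: mult.assoc)
    moreover have "0 < sqrt (\<kappa> + 1) * (A + \<kappa> * norm (s t)) / A"
      using A_pos k1 by (intro divide_pos_pos mult_pos_pos add_pos_nonneg) auto
    ultimately have "ln (sqrt (\<kappa> + 1) * (A + \<kappa> * norm (s t)) / A) \<le> ?b"
      by (subst ln_le_cancel_iff) auto
    then show ?thesis using k1 by (simp add: N_required_def)
  qed
  \<comment> \<open>Only the initial term depends on \<open>y_init\<close>; the remaining
    \<open>T\<close> terms share one bound.\<close>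
  have "(\<Sum>t\<le>T. N_required \<kappa> A ?d0 s t) = ?a + (\<Sum>t<T. N_required \<kappa> A ?d0 s (Suc t))"
    by (simp add: sum.atMost_shift N_required_def)
  also have "\<dots> \<le> ?a + (\<Sum>t<T. 2 * sqrt \<kappa> * ?b)"
    using step by (intro add_left_mono sum_mono) auto
  finally have sum: "(\<Sum>t\<le>T. N_required \<kappa> A ?d0 s t) \<le> ?a + 2 * sqrt \<kappa> * real T * ?b"
    by (simp add: mult_ac)
  have "(\<Sum>t\<le>T. real (N t)) \<le> ?a + 2 * sqrt \<kappa> * real T * ?b + \<delta> * (real T + 1)"
    if "\<forall>t\<le>T. real (N t) \<le> N_required \<kappa> A ?d0 s t + \<delta>" for \<delta>
  proof -
    have "(\<Sum>t\<le>T. real (N t)) \<le> (\<Sum>t\<le>T. N_required \<kappa> A ?d0 s t + \<delta>)"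
      using that by (intro sum_mono) auto
    then show ?thesis using sum by (simp add: sum.distrib algebra_simps)
  qed
  then show ?thesis
    using ex sum reached_T_bound[OF _ reached[OF order_refl]] T_bound_soft_O unfolding Delta[symmetric] by blast
qed

end
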